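(* Let $m\ge n$ be positive integers, let $\Omega\subset\mathbb{R}^n$ be a connected open set and let $K\subset\mathbb{M}^{m\times n}$ be a bounded set (not necessarily finite) such that $\operatorname{rank}(A-A')=n$ for all $A,A'\in K$ with $A\neq A'$. Suppose that there exist $n-1$ independent hyperplanes $\pi_1,\dots,\pi_{n-1}$ in $\mathbb{R}^n$ and $n-1$ vector subspaces $\tau_1,\dots,\tau_{n-1}$ of $\mathbb{R}^m$, each of dimension $n-1$, such that $$A(\pi_r)\subseteq\tau_r\quad\text{for every }A\in K\text{ and every }r=1,\dots,n-1.$$ Then every measurable matrix field $B:\Omega\to K$ satisfying $\operatorname{Div}B=0$ in $\mathcal{D}'(\Omega,\mathbb{R}^m)$ is constant (almost everywhere in $\Omega$).
   Context: $\mathbb{M}^{m\times n}$ denotes the set of real $m\times n$ matrices, acting on vectors of $\mathbb{R}^n$ by left multiplication. Hyperplanes here are $(n-1)$-dimensional vector subspaces of $\mathbb{R}^n$; hyperplanes $\pi_1,\dots,\pi_{n-1}$ are independent if unit vectors $v_1,\dots,v_{n-1}$ with $v_r$ orthogonal to $\pi_r$ are linearly independent. For $B\in L^\infty(\Omega,\mathbb{M}^{m\times n})$, the condition $\operatorname{Div}B=0$ in $\mathcal{D}'(\Omega,\mathbb{R}^m)$ means that every row of $B$ is divergence free in the distributional sense, i.e. for each row $b$ of $B$ one has $\int_\Omega\langle b(x),\nabla\varphi(x)\rangle\,dx=0$ for every $\varphi\in C_0^\infty(\Omega)$. Measurable functions are identified when they agree almost everywhere. *)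

theory Defs
  imports "HOL-Analysis.Analysis"
begin

text \<open>Globally defined functions of class \<open>C\<^sup>k\<close>: a function is \<open>C\<^sup>k\<^sup>+\<^sup>1\<close> iff it is
  differentiable everywhere and all its partial derivatives are \<open>C\<^sup>k\<close>.\<close>

primrec C_k :: "nat \<Rightarrow> ('a::euclidean_space \<Rightarrow> real) \<Rightarrow> bool" where
  "C_k 0 f \<longleftrightarrow> continuous_on UNIV f"
| "C_k (Suc k) f \<longleftrightarrow> (\<forall>x. f differentiable (at x)) \<and>
     (\<forall>b\<in>Basis. C_k k (\<lambda>x. frechet_derivative f (at x) b))"

text \<open>\<open>C\<^sub>0\<^sup>\<infinity>(\<Omega>)\<close>. Its members are taken to be functions on the whole space (extended by zero);
  their support is a compact subset of \<open>\<Omega>\<close>.\<close>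

definition test_functions :: "'a::euclidean_space set \<Rightarrow> ('a \<Rightarrow> real) set" where
  "test_functions \<Omega> = {\<phi>. (\<forall>k. C_k k \<phi>) \<and>
     compact (closure {x. \<phi> x \<noteq> 0}) \<and> closure {x. \<phi> x \<noteq> 0} \<subseteq> \<Omega>}"

definition gradient :: "(real^'n \<Rightarrow> real) \<Rightarrow> real^'n \<Rightarrow> real^'n" where
  "gradient f x = (\<chi> i. frechet_derivative f (at x) (axis i 1))"

text \<open>The next two notions are intended for measurable, essentially bounded fields; the integrand is
  then integrable for every test function, so that the convention that the integral of a
  non-integrable function is zero plays no role.\<close>

definition divergence_free_on :: "(real^'n) set \<Rightarrow> (real^'n \<Rightarrow> real^'n) \<Rightarrow> bool" where
  "divergence_free_on \<Omega> b \<longleftrightarrow>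
     (\<forall>\<phi>\<in>test_functions \<Omega>. (LINT x|lebesgue_on \<Omega>. b x \<bullet> gradient \<phi> x) = 0)"

definition Div_free_on :: "(real^'n) set \<Rightarrow> (real^'n \<Rightarrow> real^'n^'m) \<Rightarrow> bool" where
  "Div_free_on \<Omega> B \<longleftrightarrow> (\<forall>i. divergence_free_on \<Omega> (\<lambda>x. row i (B x)))"

text \<open>Linear independence of the family of normals \<open>v\<close> is injectivity together with linear
  independence of the image set.\<close>

definition independent_hyperplanes :: "'i set \<Rightarrow> ('i \<Rightarrow> 'a::euclidean_space set) \<Rightarrow> bool" where
  "independent_hyperplanes I \<pi> \<longleftrightarrow>
     (\<exists>v. (\<forall>r\<in>I. norm (v r) = 1 \<and> (\<forall>x\<in>\<pi> r. orthogonal (v r) x)) \<and>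
          inj_on v I \<and> independent (v ` I))"

end

theory Submission
  imports Defs
begin

text \<open>
  The field is shown to be invariant along \<open>n\<close> independent directions, each time by finding components
  that do not vary along the direction and that determine the matrices of \<open>K\<close>.

  Let \<open>v\<^sub>r\<close> be the unit normal of \<open>\<pi>\<^sub>r\<close> and let \<open>w\<close> be orthogonal to \<open>\<tau>\<^sub>r\<close>. For \<open>A \<in> K\<close> the row vector
  \<open>w\<^sup>T A\<close> annihilates \<open>\<pi>\<^sub>r\<close>, hence \<open>w\<^sup>T A = c v\<^sub>r\<close> with \<open>c = \<langle>w, A v\<^sub>r\<rangle>\<close>. So \<open>w\<^sup>T B\<close> is a divergence-free
  field of constant direction \<open>v\<^sub>r\<close>, which says that its coefficient \<open>\<langle>w, B v\<^sub>r\<rangle>\<close> does not vary along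
  \<open>v\<^sub>r\<close>. When \<open>w\<close> ranges over the orthogonal complement of \<open>\<tau>\<^sub>r\<close>, these coefficients determine a matrix
  in \<open>K\<close>: if they agreed for \<open>A \<noteq> A'\<close>, the range of \<open>A - A'\<close> would lie in \<open>\<tau>\<^sub>r\<close>, of dimension \<open>n - 1\<close>
  (\<open>normal_image_separates\<close>). Therefore the whole field \<open>B\<close> is invariant along every \<open>v\<^sub>r\<close>.

  One direction \<open>e\<close>, orthogonal to all \<open>v\<^sub>r\<close>, is left. In the divergence of a row all derivatives along
  directions orthogonal to \<open>e\<close> now drop out, so that \<open>B e\<close> does not vary along \<open>e\<close>; as \<open>A - A'\<close> is
  injective for distinct \<open>A, A' \<in> K\<close>, the vector \<open>B e\<close> determines \<open>B\<close>, and \<open>B\<close> is invariant along \<open>e\<close> too.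
  A field that is invariant along all directions on a connected open set is constant.

  The argument passes back and forth between two notions of invariance. The weak one, a vanishing
  distributional derivative, comes from the divergence and is linear in the direction. The
  pointwise one, \<open>f(x + t u) = f(x)\<close> for almost every \<open>x\<close>, is the one that survives the nonlinear passage
  from a few components of a matrix to the matrix itself (\<open>translation_invariant_if_separating\<close>). Their
  equivalence for bounded functions rests on differentiating the pairing of \<open>f\<close> with the translates of
  a test function (\<open>translated_pairing_has_derivative\<close>) and on the fundamental lemma of the calculus
  of variations (\<open>AE_eq_0_if_test_integrals_eq_0\<close>).
\<close>

section \<open>Calculus of \<open>C\<^sup>k\<close> functions\<close>

text \<open>The defining recursion of \<^const>\<open>C_k\<close> mentions \<^const>\<open>frechet_derivative\<close>; this rule lets
  any known derivative be used instead, which is how all the closure properties below are proved.\<close>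

lemma C_k_SucI:
  assumes "\<And>x. (f has_derivative D x) (at x)" and "\<And>b. b \<in> Basis \<Longrightarrow> C_k k (\<lambda>x. D x b)"
  shows "C_k (Suc k) f"
proof -
  have "frechet_derivative f (at x) = D x" for x
    using frechet_derivative_at[OF assms(1)] by simp
  then show ?thesis
    using assms by (auto simp: differentiable_def)
qed

lemma C_k_Suc_has_derivative:
  "C_k (Suc k) f \<Longrightarrow> (f has_derivative frechet_derivative f (at x)) (at x)"
  by (simp add: frechet_derivative_works)

lemma C_k_imp_continuous_on: "C_k k f \<Longrightarrow> continuous_on S f"
  by (cases k) (auto intro: continuous_on_subset continuous_at_imp_continuous_on
      differentiable_imp_continuous_within)

lemma C_k_decrease: "C_k (Suc k) f \<Longrightarrow> C_k k f"
proof (induction k arbitrary: f)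
  case 0
  then show ?case
    using C_k_imp_continuous_on[OF 0] by (simp only: C_k.simps(1))
next
  case (Suc k)
  then show ?case by (simp only: C_k.simps(2)) blast
qed

lemma C_k_const: "C_k k (\<lambda>x. c)"
  by (induction k arbitrary: c) (auto simp: frechet_derivative_const)

lemma C_k_add:
  assumes "C_k k f" "C_k k g"
  shows "C_k k (\<lambda>x. f x + g x)"
  using assms
proof (induction k arbitrary: f g)
  case 0
  then show ?case by (auto intro: continuous_intros)
next
  case (Suc k)
  show ?case
    by (rule C_k_SucI[OF has_derivative_add[OF
          Suc.prems[THEN C_k_Suc_has_derivative]]])
      (use Suc in auto)
qed

lemma C_k_mult:
  assumes "C_k k f" "C_k k g"
  shows "C_k k (\<lambda>x. f x * g x)"
  using assms
proof (induction k arbitrary: f g)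
  case 0
  then show ?case by (auto intro: continuous_intros)
next
  case (Suc k)
  have "C_k k f" "C_k k g"
    using Suc.prems C_k_decrease by blast+
  then show ?case
    by (intro C_k_SucI[OF has_derivative_mult[OF Suc.prems[THEN C_k_Suc_has_derivative]]] C_k_add)
      (use Suc in auto)
qed

lemma C_k_prod:
  assumes "\<And>i. i \<in> I \<Longrightarrow> C_k k (f i)"
  shows "C_k k (\<lambda>x. \<Prod>i\<in>I. f i x)"
  using assms by (induction I rule: infinite_finite_induct) (auto intro: C_k_const C_k_mult)

lemma has_derivative_translate:
  assumes "f differentiable (at (x - a))"
  shows "((\<lambda>x. f (x - a)) has_derivative frechet_derivative f (at (x - a))) (at x)"
proof -
  have "(f \<circ> (\<lambda>x. x - a) has_derivative frechet_derivative f (at (x - a)) \<circ> (\<lambda>h. h)) (at x)"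
    by (rule diff_chain_at)
      (use assms in \<open>auto simp: frechet_derivative_works intro!: derivative_eq_intros\<close>)
  then show ?thesis by (simp add: o_def)
qed

lemma C_k_translate:
  assumes "C_k k f"
  shows "C_k k (\<lambda>x. f (x - a))"
  using assms
proof (induction k arbitrary: f)
  case 0
  then have "continuous_on UNIV (f \<circ> (\<lambda>x. x - a))"
    by (intro continuous_on_compose continuous_intros) (auto intro: continuous_on_subset)
  then show ?case by (simp add: o_def)
next
  case (Suc k)
  show ?case
    by (rule C_k_SucI[OF has_derivative_translate]) (use Suc in auto)
qed

section \<open>Smooth bump functions\<close>

text \<open>The functions \<open>p(1/t) exp(-1/t)\<close> on the positive half-line, extended by zero. Allowing an
  arbitrary polynomial \<open>p\<close> makes the family closed under differentiation, so smoothness of all its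
  members follows by one induction; \<open>p = 1\<close> gives the classical flat function.\<close>

definition flat_exp :: "real poly \<Rightarrow> real \<Rightarrow> real" where
  "flat_exp p t = (if 0 < t then poly p (1 / t) * exp (- (1 / t)) else 0)"

text \<open>With \<open>y = 1/t\<close> this is the decay of \<open>p(y) exp(-y)\<close> at infinity.\<close>

lemma flat_exp_tendsto_0: "((flat_exp p) \<longlongrightarrow> 0) (at_right 0)"
proof -
  have *: "((\<lambda>x. poly p x * exp (- x)) \<longlongrightarrow> 0) at_top"
  proof -
    have "((\<lambda>x. \<Sum>i\<le>degree p. coeff p i * (x ^ i / exp x)) \<longlongrightarrow> (\<Sum>i\<le>degree p. coeff p i * 0)) at_top"
      by (intro tendsto_intros tendsto_power_div_exp_0)
    then show ?thesis
      by (simp add: poly_altdef sum_distrib_right exp_minus divide_inverse mult.assoc)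
  qed
  have "((\<lambda>t. poly p (inverse t) * exp (- (inverse t))) \<longlongrightarrow> 0) (at_right 0)"
    by (rule filterlim_compose[OF * filterlim_inverse_at_top_right])
  then show ?thesis
    by (rule Lim_transform_eventually)
      (auto simp: flat_exp_def eventually_at_right_field inverse_eq_divide intro: exI[of _ 1])
qed

text \<open>For \<open>t > 0\<close> the chain rule turns \<open>p\<close> into \<open>X\<^sup>2 (p - p')\<close>. At \<open>t = 0\<close> the difference quotient from
  the right is the member of the family with polynomial \<open>X p\<close>, and so it tends to zero.\<close>

lemma DERIV_flat_exp:
  "(flat_exp p has_real_derivative flat_exp ([:0, 0, 1:] * (p - pderiv p)) t) (at t)"
proof -
  consider "t > 0" | "t < 0" | "t = 0" by linarith
  then show ?thesis
  proof cases
    case 1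
    have "((\<lambda>t. poly p (1 / t) * exp (- (1 / t))) has_real_derivative
        flat_exp ([:0, 0, 1:] * (p - pderiv p)) t) (at t)"
      using 1 by (auto intro!: derivative_eq_intros DERIV_chain2[OF poly_DERIV]
          simp: flat_exp_def field_simps power2_eq_square)
    then show ?thesis
      by (rule has_field_derivative_transform_within_open[where S="{0<..}"])
        (use 1 in \<open>auto simp: flat_exp_def\<close>)
  next
    case 2
    have "((\<lambda>t. 0) has_real_derivative flat_exp ([:0, 0, 1:] * (p - pderiv p)) t) (at t)"
      using 2 by (auto simp: flat_exp_def)
    then show ?thesis
      by (rule has_field_derivative_transform_within_open[where S="{..<0}"])
        (use 2 in \<open>auto simp: flat_exp_def\<close>)
  next
    case 3
    have "((\<lambda>y. (flat_exp p y - flat_exp p 0) / (y - 0)) \<longlongrightarrow> 0) (at 0)"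
    proof (rule filterlim_split_at)
      show "((\<lambda>y. (flat_exp p y - flat_exp p 0) / (y - 0)) \<longlongrightarrow> 0) (at_left 0)"
        by (rule tendsto_eventually)
          (auto simp: flat_exp_def eventually_at_left_field intro: exI[of _ "-1"])
      have "eventually (\<lambda>y. flat_exp (pCons 0 p) y = (flat_exp p y - flat_exp p 0) / (y - 0)) (at_right 0)"
        by (auto simp: flat_exp_def eventually_at_right_field intro: exI[of _ 1])
      with flat_exp_tendsto_0
      show "((\<lambda>y. (flat_exp p y - flat_exp p 0) / (y - 0)) \<longlongrightarrow> 0) (at_right 0)"
        by (rule Lim_transform_eventually)
    qed
    then show ?thesis
      using 3 by (simp add: has_field_derivative_iff flat_exp_def[of _ 0])
  qed
qed

lemma C_k_flat_exp: "C_k k (\<lambda>x. flat_exp p (x \<bullet> v + d))"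
proof (induction k arbitrary: p)
  case 0
  have "continuous_on UNIV (flat_exp p)"
    using DERIV_flat_exp DERIV_continuous_on by blast
  then have "continuous_on UNIV (flat_exp p \<circ> (\<lambda>x. x \<bullet> v + d))"
    by (intro continuous_on_compose continuous_intros) (auto intro: continuous_on_subset)
  then show ?case by (simp add: o_def)
next
  case (Suc k)
  have "((\<lambda>x. flat_exp p (x \<bullet> v + d)) has_derivative
      (\<lambda>h. (h \<bullet> v) * flat_exp ([:0, 0, 1:] * (p - pderiv p)) (x \<bullet> v + d))) (at x)" for x
    by (rule DERIV_compose_FDERIV[OF DERIV_flat_exp]) (auto intro!: derivative_eq_intros)
  then show ?case
    by (rule C_k_SucI) (intro C_k_mult C_k_const Suc.IH)
qed

text \<open>Smooth functions that converge to the indicator of an open box as \<open>k\<close> grows, because the dilates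
  \<open>flat_exp 1 (k t)\<close> increase to the indicator of \<open>t > 0\<close>. The dilation factor is \<open>Suc k\<close> so that it
  is positive for every \<open>k\<close>.\<close>

definition box_bump :: "nat \<Rightarrow> 'a \<Rightarrow> 'a \<Rightarrow> 'a::euclidean_space \<Rightarrow> real" where
  "box_bump k a b x = (\<Prod>i\<in>Basis. flat_exp 1 (real (Suc k) * (x \<bullet> i - a \<bullet> i)) *
     flat_exp 1 (real (Suc k) * (b \<bullet> i - x \<bullet> i)))"

lemma flat_exp_1_bounds: "0 \<le> flat_exp 1 t" "flat_exp 1 t \<le> 1"
  by (auto simp: flat_exp_def)

lemma box_bump_bounds: "0 \<le> box_bump k a b x" "box_bump k a b x \<le> 1"
  unfolding box_bump_def
  by (auto intro!: prod_nonneg prod_le_1 mult_nonneg_nonneg mult_le_one flat_exp_1_bounds)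

lemma box_bump_eq_0: "x \<notin> box a b \<Longrightarrow> box_bump k a b x = 0"
  unfolding box_bump_def mem_box
  by (auto simp: flat_exp_def zero_less_mult_iff intro!: prod_zero)

lemma C_k_box_bump: "C_k m (box_bump k a b)"
proof -
  have "C_k m (\<lambda>x. \<Prod>i\<in>Basis. flat_exp 1 (x \<bullet> (real (Suc k) *\<^sub>R i) + - (real (Suc k) * (a \<bullet> i))) *
     flat_exp 1 (x \<bullet> (- real (Suc k) *\<^sub>R i) + real (Suc k) * (b \<bullet> i)))"
    by (intro C_k_prod C_k_mult C_k_flat_exp)
  moreover have "box_bump k a b = (\<lambda>x. \<Prod>i\<in>Basis. flat_exp 1 (x \<bullet> (real (Suc k) *\<^sub>R i) + - (real (Suc k) * (a \<bullet> i))) *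
     flat_exp 1 (x \<bullet> (- real (Suc k) *\<^sub>R i) + real (Suc k) * (b \<bullet> i)))"
    by (rule ext, unfold box_bump_def, intro prod.cong refl)
      (simp add: algebra_simps)
  ultimately show ?thesis by simp
qed

lemma box_bump_test_function:
  assumes "cbox a b \<subseteq> U"
  shows "box_bump k a b \<in> test_functions U"
proof -
  have "closure {x. box_bump k a b x \<noteq> 0} \<subseteq> cbox a b"
    by (rule closure_minimal) (use box_bump_eq_0[of _ a b k] box_subset_cbox[of a b] in auto)
  moreover from this have "compact (closure {x. box_bump k a b x \<noteq> 0})"
    by (metis bounded_cbox bounded_subset closed_closure compact_eq_bounded_closed)
  ultimately show ?thesis
    using assms C_k_box_bump by (auto simp: test_functions_def)
qed

lemma flat_exp_1_tendsto_1:
  assumes "0 < t"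
  shows "(\<lambda>k. flat_exp 1 (real (Suc k) * t)) \<longlonglongrightarrow> 1"
proof -
  have "(\<lambda>k. exp (- (1 / t) * inverse (real (Suc k)))) \<longlonglongrightarrow> exp (- (1 / t) * 0)"
    by (intro tendsto_intros LIMSEQ_inverse_real_of_nat)
  then show ?thesis
    using assms by (simp add: flat_exp_def divide_inverse ac_simps)
qed

lemma box_bump_tendsto_indicator: "(\<lambda>k. box_bump k a b x) \<longlonglongrightarrow> indicator (box a b) x"
proof (cases "x \<in> box a b")
  case True
  then have "(\<lambda>k. box_bump k a b x) \<longlonglongrightarrow> (\<Prod>i\<in>(Basis::'a set). 1 * 1)"
    unfolding box_bump_def
    by (intro tendsto_intros flat_exp_1_tendsto_1) (auto simp: mem_box)
  with True show ?thesis by simp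
next
  case False
  then show ?thesis by (simp add: box_bump_eq_0)
qed


section \<open>The fundamental lemma of the calculus of variations\<close>

text \<open>Open boxes form an intersection-stable generator of the Borel sets, so inside an open box whose
  closed box lies in \<open>U\<close> the integral of \<open>g\<close> vanishes over every Borel set, in particular over the sets
  where \<open>g\<close> is positive and where it is negative. Countably many such boxes cover \<open>U\<close>.\<close>

lemma AE_eq_0_if_box_integrals_eq_0:
  fixes g :: "'a::euclidean_space \<Rightarrow> real"
  assumes [measurable]: "g \<in> borel_measurable borel" and bnd: "\<And>x. \<bar>g x\<bar> \<le> M"
    and U: "open U"
    and box: "\<And>a b. cbox a b \<subseteq> U \<Longrightarrow> (LINT x|lborel. indicator (box a b) x * g x) = 0"
  shows "AE x in lborel. x \<in> U \<longrightarrow> g x = 0"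
proof -
  have int: "integrable lborel (\<lambda>x. indicator (A \<inter> box a b) x * g x)" if [measurable]: "A \<in> sets borel" for A a b
  proof (rule Bochner_Integration.integrable_bound)
    show "integrable lborel (\<lambda>x. M * indicator (box a b) x)"
      by (intro integrable_mult_right integrable_real_indicator) (auto simp: emeasure_lborel_box_eq)
  qed (use bnd in \<open>auto simp: indicator_def intro: order_trans[OF _ abs_ge_self]\<close>)
  have zero: "(LINT x|lborel. indicator (A \<inter> box a b) x * g x) = 0"
    if cb: "cbox a b \<subseteq> U" and A: "A \<in> sets borel" for A a b
  proof -
    have "Int_stable (range (\<lambda>(a, b). box a b :: 'a set))"
      by (auto simp: Int_stable_def box_Int_box)
    moreover have "(range (\<lambda>(a, b). box a b :: 'a set)) \<subseteq> Pow UNIV"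
      by auto
    moreover have "A \<in> sigma_sets UNIV (range (\<lambda>(a, b). box a b))"
      using A unfolding borel_eq_box by simp
    ultimately show ?thesis
    proof (induction rule: sigma_sets_induct_disjoint)
      case (basic A)
      then obtain c d where cd: "A = box c d" by auto
      show ?case
      proof (cases "A \<inter> box a b = {}")
        case False
        obtain p q where pq: "A \<inter> box a b = box p q"
          using cd by (auto simp: box_Int_box)
        then have "box p q \<noteq> {}" "box p q \<subseteq> box a b"
          using False by auto
        then have "cbox p q \<subseteq> U"
          using cb by (metis closure_box closure_minimal closed_cbox box_subset_cbox subset_trans)
        then show ?thesis using box pq by simp
      qed simp
    next
      case empty
      then show ?case by simp
    next
      case (compl A)
      then have [measurable]: "A \<in> sets borel"
        by (simp add: borel_eq_box)
      have "(LINT x|lborel. indicator ((UNIV - A) \<inter> box a b) x * g x) =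
          (LINT x|lborel. indicator (UNIV \<inter> box a b) x * g x - indicator (A \<inter> box a b) x * g x)"
        by (intro Bochner_Integration.integral_cong) (auto simp: indicator_def)
      also have "\<dots> = (LINT x|lborel. indicator (UNIV \<inter> box a b) x * g x)
          - (LINT x|lborel. indicator (A \<inter> box a b) x * g x)"
        by (intro Bochner_Integration.integral_diff int) auto
      finally show ?case using compl box[OF cb] by simp
    next
      case (union F)
      then have [measurable]: "\<And>i. F i \<in> sets borel"
        by (simp add: borel_eq_box subset_eq)
      have "i \<noteq> j \<Longrightarrow> (F i \<inter> box a b) \<inter> (F j \<inter> box a b) = {}" for i j
        using union(1) by (auto simp: disjoint_family_on_def)
      moreover have "set_integrable lborel (\<Union>i. F i \<inter> box a b) g"
        using int[of "\<Union>(range F)" a b] by (simp add: set_integrable_def)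
      ultimately have "(LINT x:(\<Union>i. F i \<inter> box a b)|lborel. g x) = (\<Sum>i. LINT x:(F i \<inter> box a b)|lborel. g x)"
        by (intro lebesgue_integral_countable_add) auto
      then show ?case
        using union by (simp add: set_lebesgue_integral_def)
    qed
  qed
  have onbox: "AE x in lborel. x \<in> box a b \<longrightarrow> g x = 0" if "cbox a b \<subseteq> U" for a b
  proof -
    define P N where "P = {x. 0 < g x}" and "N = {x. g x < 0}"
    have [measurable]: "P \<in> sets borel" "N \<in> sets borel"
      by (simp_all add: P_def N_def)
    have "0 \<le> indicator (P \<inter> box a b) x * g x" "0 \<le> - (indicator (N \<inter> box a b) x * g x)" for x
      by (auto simp: P_def N_def indicator_def)
    then have "AE x in lborel. indicator (P \<inter> box a b) x * g x = 0"
      "AE x in lborel. - (indicator (N \<inter> box a b) x * g x) = 0"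
      by (subst integral_nonneg_eq_0_iff_AE[symmetric]; use int zero[OF that] in simp)+
    then show ?thesis
      by eventually_elim (auto simp: P_def N_def indicator_def split: if_splits)
  qed
  define \<F> where "\<F> = {box a b | a b. cbox a b \<subseteq> U}"
  have "\<Union>\<F> = U"
  proof
    show "\<Union>\<F> \<subseteq> U" using box_subset_cbox by (fastforce simp: \<F>_def)
    show "U \<subseteq> \<Union>\<F>"
    proof
      fix x assume "x \<in> U"
      then obtain a b where "x \<in> box a b" "cbox a b \<subseteq> U"
        by (rule open_contains_cbox[OF U])
      then show "x \<in> \<Union>\<F>" by (auto simp: \<F>_def)
    qed
  qed
  moreover obtain \<F>' where \<F>': "\<F>' \<subseteq> \<F>" "countable \<F>'" "\<Union>\<F>' = \<Union>\<F>"
    by (rule Lindelof[of \<F>]) (auto simp: \<F>_def)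
  moreover have "AE x in lborel. \<forall>S\<in>\<F>'. x \<in> S \<longrightarrow> g x = 0"
    using \<F>' onbox by (subst AE_ball_countable) (auto simp: \<F>_def)
  ultimately show ?thesis
    by (auto elim!: eventually_mono)
qed

text \<open>Testing against the bumps that converge to the indicator of a box yields the box integrals.\<close>

lemma AE_eq_0_if_test_integrals_eq_0:
  fixes g :: "'a::euclidean_space \<Rightarrow> real"
  assumes [measurable]: "g \<in> borel_measurable borel" and bnd: "\<And>x. \<bar>g x\<bar> \<le> M"
    and U: "open U"
    and test: "\<And>\<psi>. \<psi> \<in> test_functions U \<Longrightarrow> (LINT x|lborel. g x * \<psi> x) = 0"
  shows "AE x in lborel. x \<in> U \<longrightarrow> g x = 0"
proof (rule AE_eq_0_if_box_integrals_eq_0[OF assms(1) bnd U])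
  fix a b :: 'a assume cb: "cbox a b \<subseteq> U"
  have [measurable]: "box_bump k a b \<in> borel_measurable borel" for k
    by (rule borel_measurable_continuous_onI[OF C_k_imp_continuous_on[OF C_k_box_bump[of 0]]])
  have "(\<lambda>k. LINT x|lborel. box_bump k a b x * g x) \<longlonglongrightarrow> (LINT x|lborel. indicator (box a b) x * g x)"
  proof (rule integral_dominated_convergence)
    show "integrable lborel (\<lambda>x. M * indicator (box a b) x)"
      by (intro integrable_mult_right integrable_real_indicator) (auto simp: emeasure_lborel_box_eq)
    show "AE x in lborel. (\<lambda>k. box_bump k a b x * g x) \<longlonglongrightarrow> indicator (box a b) x * g x"
      by (intro AE_I2 tendsto_intros box_bump_tendsto_indicator)
    have "\<bar>box_bump k a b x * g x\<bar> \<le> M * indicator (box a b) x" for k x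
    proof (cases "x \<in> box a b")
      case True
      have "\<bar>box_bump k a b x * g x\<bar> \<le> 1 * M"
        unfolding abs_mult using bnd box_bump_bounds[of k a b x] by (intro mult_mono) auto
      with True show ?thesis by simp
    qed (simp add: box_bump_eq_0)
    then show "AE x in lborel. norm (box_bump k a b x * g x) \<le> M * indicator (box a b) x" for k
      by simp
  qed auto
  then show "(LINT x|lborel. indicator (box a b) x * g x) = 0"
    using test[OF box_bump_test_function[OF cb]] by (simp add: mult.commute LIMSEQ_const_iff)
qed


section \<open>Directional derivatives and translates of test functions\<close>

abbreviation directional_derivative :: "('a::euclidean_space \<Rightarrow> real) \<Rightarrow> 'a \<Rightarrow> 'a \<Rightarrow> real" where
  "directional_derivative \<phi> u x \<equiv> frechet_derivative \<phi> (at x) u"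

lemma test_function_has_derivative:
  "\<phi> \<in> test_functions \<Omega> \<Longrightarrow> (\<phi> has_derivative frechet_derivative \<phi> (at x)) (at x)"
  using C_k_Suc_has_derivative[of 0 \<phi>] by (auto simp: test_functions_def simp del: C_k.simps)

lemma test_function_continuous_on: "\<phi> \<in> test_functions \<Omega> \<Longrightarrow> continuous_on S \<phi>"
  using C_k_imp_continuous_on[of 0 \<phi>] by (auto simp: test_functions_def simp del: C_k.simps)

lemma directional_derivative_sum_Basis:
  assumes "\<phi> \<in> test_functions \<Omega>"
  shows "directional_derivative \<phi> u x = (\<Sum>b\<in>Basis. (u \<bullet> b) * directional_derivative \<phi> b x)"
proof -
  have lin: "linear (frechet_derivative \<phi> (at x))"
    using test_function_has_derivative[OF assms] has_derivative_linear by blast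
  have "frechet_derivative \<phi> (at x) (\<Sum>b\<in>Basis. (u \<bullet> b) *\<^sub>R b)
      = (\<Sum>b\<in>Basis. (u \<bullet> b) * directional_derivative \<phi> b x)"
    by (simp add: linear_sum[OF lin] linear_scale[OF lin])
  then show ?thesis by (simp add: euclidean_representation)
qed

lemma continuous_on_directional_derivative:
  assumes "\<phi> \<in> test_functions \<Omega>"
  shows "continuous_on S (directional_derivative \<phi> u)"
proof -
  have "C_k 1 \<phi>" using assms by (simp add: test_functions_def del: C_k.simps)
  then have "continuous_on S (directional_derivative \<phi> b)" if "b \<in> Basis" for b
    using that by (auto intro: continuous_on_subset)
  then have "continuous_on S (\<lambda>x. \<Sum>b\<in>Basis. (u \<bullet> b) * directional_derivative \<phi> b x)"
    by (intro continuous_intros) auto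
  moreover have "directional_derivative \<phi> u = (\<lambda>x. \<Sum>b\<in>Basis. (u \<bullet> b) * directional_derivative \<phi> b x)"
    by (rule ext) (rule directional_derivative_sum_Basis[OF assms])
  ultimately show ?thesis by (simp only:)
qed

lemma test_function_eq_0: "x \<notin> closure {x. \<phi> x \<noteq> 0} \<Longrightarrow> \<phi> x = (0::real)"
  using closure_subset[of "{x. \<phi> x \<noteq> 0}"] by blast

lemma directional_derivative_eq_0:
  fixes \<phi> :: "'a::euclidean_space \<Rightarrow> real"
  assumes "x \<notin> closure {x. \<phi> x \<noteq> 0}"
  shows "directional_derivative \<phi> u x = 0"
proof -
  have "frechet_derivative (\<lambda>x. 0) (at x) = frechet_derivative \<phi> (at x)"
  proof (rule frechet_derivative_transform_within_open[of _ _ "- closure {x. \<phi> x \<noteq> 0}"])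
    show "0 = \<phi> y" if "y \<in> - closure {x. \<phi> x \<noteq> 0}" for y
      using that test_function_eq_0[of y \<phi>] by simp
  qed (use assms in auto)
  then show ?thesis by (metis frechet_derivative_const)
qed

lemma test_function_support:
  assumes "\<phi> \<in> test_functions \<Omega>"
  shows "compact (closure {x. \<phi> x \<noteq> 0})" "closure {x. \<phi> x \<noteq> 0} \<subseteq> \<Omega>"
  using assms by (auto simp: test_functions_def)

lemma continuous_compact_support_bounded:
  fixes \<psi> :: "'a::euclidean_space \<Rightarrow> real"
  assumes "continuous_on UNIV \<psi>" "compact S" "\<And>x. x \<notin> S \<Longrightarrow> \<psi> x = 0"
  obtains C where "0 \<le> C" "\<And>x. \<bar>\<psi> x\<bar> \<le> C"
proof -
  have "compact (\<psi> ` S)"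
    using assms continuous_on_subset compact_continuous_image by blast
  then obtain C where C: "\<And>x. x \<in> S \<Longrightarrow> \<bar>\<psi> x\<bar> \<le> C"
    by (metis compact_imp_bounded bounded_iff imageI real_norm_def)
  show thesis
  proof (rule that[of "max C 0"])
    show "\<bar>\<psi> x\<bar> \<le> max C 0" for x
      using C[of x] assms(3)[of x] by (cases "x \<in> S") auto
  qed simp
qed

lemma directional_derivative_bounded:
  assumes "\<phi> \<in> test_functions \<Omega>"
  obtains C where "0 \<le> C" "\<And>x. \<bar>directional_derivative \<phi> u x\<bar> \<le> C"
  using continuous_compact_support_bounded[OF continuous_on_directional_derivative[OF assms]
      test_function_support(1)[OF assms]] directional_derivative_eq_0 by metis

lemma integrable_bounded_times_compact_support:
  fixes f \<psi> :: "'a::euclidean_space \<Rightarrow> real"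
  assumes [measurable]: "f \<in> borel_measurable borel" and f: "\<And>x. \<bar>f x\<bar> \<le> M"
    and \<psi>: "continuous_on UNIV \<psi>" "compact S" "\<And>x. x \<notin> S \<Longrightarrow> \<psi> x = 0"
  shows "integrable lborel (\<lambda>x. f x * \<psi> x)"
proof -
  obtain C where C: "0 \<le> C" "\<And>x. \<bar>\<psi> x\<bar> \<le> C"
    using continuous_compact_support_bounded[OF \<psi>] by blast
  have [measurable]: "\<psi> \<in> borel_measurable borel" "S \<in> sets borel"
    using \<psi> by (auto intro: borel_measurable_continuous_onI borel_compact)
  show ?thesis
  proof (rule Bochner_Integration.integrable_bound)
    show "integrable lborel (\<lambda>x. M * C * indicator S x)"
      using emeasure_compact_finite[OF \<psi>(2)]
      by (intro integrable_mult_right integrable_real_indicator) auto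
    have "\<bar>f x * \<psi> x\<bar> \<le> \<bar>M * C * indicator S x\<bar>" for x
    proof (cases "x \<in> S")
      case True
      have "\<bar>f x * \<psi> x\<bar> \<le> M * C"
        unfolding abs_mult using f[of x] C by (intro mult_mono) auto
      with True show ?thesis by simp
    qed (simp add: \<psi>)
    then show "AE x in lborel. norm (f x * \<psi> x) \<le> norm (M * C * indicator S x)" by simp
  qed simp
qed

lemma integrable_times_test_function:
  assumes "f \<in> borel_measurable borel" "\<And>x. \<bar>f x\<bar> \<le> M" "\<phi> \<in> test_functions \<Omega>"
  shows "integrable lborel (\<lambda>x. f x * \<phi> x)"
  using assms test_function_continuous_on test_function_support(1) test_function_eq_0
  by (intro integrable_bounded_times_compact_support[where S = "closure {x. \<phi> x \<noteq> 0}"]) blast+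

lemma integrable_times_directional_derivative:
  assumes "f \<in> borel_measurable borel" "\<And>x. \<bar>f x\<bar> \<le> M" "\<phi> \<in> test_functions \<Omega>"
  shows "integrable lborel (\<lambda>x. f x * directional_derivative \<phi> u x)"
  using assms continuous_on_directional_derivative test_function_support(1) directional_derivative_eq_0
  by (intro integrable_bounded_times_compact_support[where S = "closure {x. \<phi> x \<noteq> 0}"]) blast+

lemma test_function_translate:
  assumes \<phi>: "\<phi> \<in> test_functions U" and UV: "\<And>x. x \<in> U \<Longrightarrow> x + a \<in> V"
  shows "(\<lambda>x. \<phi> (x - a)) \<in> test_functions V"
proof -
  have "{x. \<phi> (x - a) \<noteq> 0} = (+) a ` {x. \<phi> x \<noteq> 0}"
    by (force simp: image_iff intro: exI[of _ "_ - a"])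
  then have "closure {x. \<phi> (x - a) \<noteq> 0} = (+) a ` closure {x. \<phi> x \<noteq> 0}"
    by (simp add: closure_translation)
  moreover from this have "compact (closure {x. \<phi> (x - a) \<noteq> 0})"
    using test_function_support(1)[OF \<phi>] by (simp only: compact_translation)
  ultimately show ?thesis
    using \<phi> UV by (auto simp: test_functions_def add.commute
        simp del: C_k.simps compact_closure intro: C_k_translate)
qed

lemma directional_derivative_translate:
  assumes "\<phi> \<in> test_functions U"
  shows "directional_derivative (\<lambda>x. \<phi> (x - a)) u x = directional_derivative \<phi> u (x - a)"
proof -
  have "\<phi> differentiable (at (x - a))"
    using test_function_has_derivative[OF assms] differentiable_def by blast
  from frechet_derivative_at[OF has_derivative_translate[OF this]] show ?thesis
    by metis
qed

lemma test_function_line_has_derivative: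
  assumes "\<phi> \<in> test_functions U"
  shows "((\<lambda>t. \<phi> (x - t *\<^sub>R u)) has_real_derivative - directional_derivative \<phi> u (x - s *\<^sub>R u)) (at s)"
proof -
  have lin: "linear (frechet_derivative \<phi> (at (x - s *\<^sub>R u)))"
    using test_function_has_derivative[OF assms] has_derivative_linear by blast
  have "(\<phi> \<circ> (\<lambda>t. x - t *\<^sub>R u) has_derivative frechet_derivative \<phi> (at (x - s *\<^sub>R u)) \<circ> (\<lambda>t. - (t *\<^sub>R u))) (at s)"
    by (rule diff_chain_at[OF _ test_function_has_derivative[OF assms]])
      (auto intro!: derivative_eq_intros)
  moreover have "frechet_derivative \<phi> (at (x - s *\<^sub>R u)) \<circ> (\<lambda>t. - (t *\<^sub>R u))
      = (*) (- directional_derivative \<phi> u (x - s *\<^sub>R u))"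
    by (auto simp: fun_eq_iff linear_neg[OF lin] linear_scale[OF lin])
  moreover have "\<phi> \<circ> (\<lambda>t. x - t *\<^sub>R u) = (\<lambda>t. \<phi> (x - t *\<^sub>R u))"
    by auto
  ultimately show ?thesis
    by (simp only: has_field_derivative_def)
qed

text \<open>Uniform bound on the difference quotients, which serves as the dominating constant below.\<close>

lemma test_function_line_Lipschitz:
  assumes "\<phi> \<in> test_functions U" and C: "\<And>x. \<bar>directional_derivative \<phi> u x\<bar> \<le> C"
  shows "\<bar>\<phi> (x - t *\<^sub>R u) - \<phi> (x - s *\<^sub>R u)\<bar> \<le> C * \<bar>t - s\<bar>"
proof -
  have "norm (\<phi> (x - t *\<^sub>R u) - \<phi> (x - s *\<^sub>R u)) \<le> C * norm (t - s)"
    by (rule field_differentiable_bound[of UNIV "\<lambda>t. \<phi> (x - t *\<^sub>R u)"])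
      (use C test_function_line_has_derivative[OF assms(1)] in auto)
  then show ?thesis by simp
qed

text \<open>Since \<open>f\<close> is merely measurable, the derivative has to fall on the test function: for small
  increments all translates of \<open>\<phi>\<close> live in one ball, on which the difference quotients are dominated
  by the Lipschitz constant, and dominated convergence applies.\<close>

lemma translated_pairing_has_derivative:
  fixes f :: "'a::euclidean_space \<Rightarrow> real"
  assumes [measurable]: "f \<in> borel_measurable borel" and f: "\<And>x. \<bar>f x\<bar> \<le> M"
    and \<phi>: "\<phi> \<in> test_functions U"
  shows "((\<lambda>t. LINT x|lborel. f x * \<phi> (x - t *\<^sub>R u)) has_real_derivative
    - (LINT x|lborel. f x * directional_derivative \<phi> u (x - s *\<^sub>R u))) (at s)"
  unfolding DERIV_def tendsto_at_iff_sequentially o_def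
proof (intro allI impI)
  fix h :: "nat \<Rightarrow> real"
  assume h0: "\<forall>i. h i \<in> UNIV - {0}" and h: "h \<longlonglongrightarrow> 0"
  let ?q = "\<lambda>n x. (\<phi> (x - (s + h n) *\<^sub>R u) - \<phi> (x - s *\<^sub>R u)) / h n"
  have tr: "(\<lambda>x. \<phi> (x - a)) \<in> test_functions UNIV" for a
    by (rule test_function_translate[OF \<phi>]) auto
  have [measurable]: "(\<lambda>x. \<phi> (x - a)) \<in> borel_measurable borel" for a
    by (rule borel_measurable_continuous_onI[OF test_function_continuous_on[OF tr]])
  have [measurable]: "directional_derivative \<phi> u \<in> borel_measurable borel"
    by (rule borel_measurable_continuous_onI[OF continuous_on_directional_derivative[OF \<phi>]])
  obtain C where C: "0 \<le> C" "\<And>x. \<bar>directional_derivative \<phi> u x\<bar> \<le> C"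
    using directional_derivative_bounded[OF \<phi>] by metis
  obtain H where H: "\<And>n. \<bar>h n\<bar> \<le> H"
    using h by (metis Bseq_def convergentI convergent_imp_Bseq real_norm_def)
  obtain R where R: "\<And>x. \<phi> x \<noteq> 0 \<Longrightarrow> norm x \<le> R"
    using test_function_support(1)[OF \<phi>] compact_imp_bounded
    by (metis bounded_iff test_function_eq_0)
  define S where "S = cball (0::'a) (R + (\<bar>s\<bar> + H) * norm u)"
  have inS: "x \<in> S" if "\<phi> (x - t *\<^sub>R u) \<noteq> 0" "\<bar>t\<bar> \<le> \<bar>s\<bar> + H" for x t
  proof -
    have "norm x \<le> norm (x - t *\<^sub>R u) + norm (t *\<^sub>R u)"
      by (metis add.commute norm_triangle_sub)
    also have "\<dots> \<le> R + (\<bar>s\<bar> + H) * norm u"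
      using R[OF that(1)] that(2) by (auto intro!: add_mono mult_right_mono)
    finally show ?thesis by (simp add: S_def)
  qed
  have "(\<lambda>n. LINT x|lborel. f x * ?q n x)
      \<longlonglongrightarrow> (LINT x|lborel. f x * - directional_derivative \<phi> u (x - s *\<^sub>R u))"
  proof (rule integral_dominated_convergence)
    show "integrable lborel (\<lambda>x. M * C * indicator S x)"
      by (intro integrable_mult_right integrable_real_indicator)
        (auto simp: S_def emeasure_compact_finite[OF compact_cball, simplified])
    have "(\<lambda>n. ?q n x) \<longlonglongrightarrow> - directional_derivative \<phi> u (x - s *\<^sub>R u)" for x
      using test_function_line_has_derivative[OF \<phi>, of x u s] h0 h
      unfolding DERIV_def tendsto_at_iff_sequentially o_def by blast
    then show "AE x in lborel. (\<lambda>n. f x * ?q n x) \<longlonglongrightarrow> f x * - directional_derivative \<phi> u (x - s *\<^sub>R u)"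
      by (intro AE_I2 tendsto_intros)
    have "\<bar>f x * ?q n x\<bar> \<le> M * C * indicator S x" for n x
    proof (cases "x \<in> S")
      case True
      have "\<bar>?q n x\<bar> \<le> C"
        using test_function_line_Lipschitz[OF \<phi> C(2), of x "s + h n" s] h0
        by (auto simp: divide_le_eq)
      then have "\<bar>f x * ?q n x\<bar> \<le> M * C"
        unfolding abs_mult using f[of x] C(1) by (intro mult_mono) auto
      with True show ?thesis by simp
    next
      case False
      have "\<bar>s + h n\<bar> \<le> \<bar>s\<bar> + H" "\<bar>s\<bar> \<le> \<bar>s\<bar> + H"
        using H[of n] by linarith+
      with False inS have "\<phi> (x - (s + h n) *\<^sub>R u) = 0" "\<phi> (x - s *\<^sub>R u) = 0"
        by blast+
      with False show ?thesis by simp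
    qed
    then show "AE x in lborel. norm (f x * ?q n x) \<le> M * C * indicator S x" for n
      by simp
  qed measurable
  moreover have "(\<lambda>n. LINT x|lborel. f x * ?q n x) =
     (\<lambda>n. ((LINT x|lborel. f x * \<phi> (x - (s + h n) *\<^sub>R u)) - (LINT x|lborel. f x * \<phi> (x - s *\<^sub>R u))) / h n)"
    by (rule ext, subst Bochner_Integration.integral_diff[symmetric])
      (auto intro!: integrable_times_test_function[OF _ f tr] simp: algebra_simps simp flip: integral_divide_zero)
  ultimately have "(\<lambda>n. ((LINT x|lborel. f x * \<phi> (x - (s + h n) *\<^sub>R u)) - (LINT x|lborel. f x * \<phi> (x - s *\<^sub>R u))) / h n)
      \<longlonglongrightarrow> (LINT x|lborel. f x * - directional_derivative \<phi> u (x - s *\<^sub>R u))"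
    by (simp only:)
  then show "(\<lambda>n. ((LINT x|lborel. f x * \<phi> (x - (s + h n) *\<^sub>R u)) - (LINT x|lborel. f x * \<phi> (x - s *\<^sub>R u))) / h n)
      \<longlonglongrightarrow> - (LINT x|lborel. f x * directional_derivative \<phi> u (x - s *\<^sub>R u))"
    by simp
qed


section \<open>Invariance along a direction\<close>

text \<open>The distributional derivative of \<open>f\<close> along \<open>u\<close> vanishes on \<open>\<Omega>\<close>. Integrating over the whole space is
  harmless because derivatives of test functions vanish outside \<open>\<Omega>\<close>.\<close>

definition weakly_invariant :: "'a::euclidean_space set \<Rightarrow> 'a \<Rightarrow> ('a \<Rightarrow> real) \<Rightarrow> bool" where
  "weakly_invariant \<Omega> u f \<longleftrightarrow>
     (\<forall>\<phi>\<in>test_functions \<Omega>. (LINT x|lborel. f x * directional_derivative \<phi> u x) = 0)"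

text \<open>The pointwise counterpart. Only points whose whole segment to the translate stays in \<open>\<Omega>\<close> are
  compared, since across a gap of \<open>\<Omega>\<close> the vanishing of the derivative gives no information. In contrast
  to the weak notion it makes sense for arbitrary values and is preserved by arbitrary maps.\<close>

definition translation_invariant :: "'a::euclidean_space set \<Rightarrow> 'a \<Rightarrow> ('a \<Rightarrow> 'b) \<Rightarrow> bool" where
  "translation_invariant \<Omega> u f \<longleftrightarrow>
     (\<forall>t U. open U \<longrightarrow> (\<forall>x\<in>U. \<forall>s\<in>{0..1}. x + s *\<^sub>R t *\<^sub>R u \<in> \<Omega>) \<longrightarrow>
       (AE x in lborel. x \<in> U \<longrightarrow> f (x + t *\<^sub>R u) = f x))"

text \<open>Linearity in the direction is the advantage of the weak notion over the pointwise one.\<close>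

lemma subspace_weakly_invariant:
  assumes "f \<in> borel_measurable borel" "\<And>x. \<bar>f x\<bar> \<le> M"
  shows "subspace {u. weakly_invariant \<Omega> u f}"
proof -
  have lin: "linear (frechet_derivative \<phi> (at x))" if "\<phi> \<in> test_functions \<Omega>" for \<phi> x
    using test_function_has_derivative[OF that] has_derivative_linear by blast
  have "(LINT x|lborel. f x * directional_derivative \<phi> (u + v) x)
     = (LINT x|lborel. f x * directional_derivative \<phi> u x) + (LINT x|lborel. f x * directional_derivative \<phi> v x)"
    if "\<phi> \<in> test_functions \<Omega>" for \<phi> u v
    by (subst Bochner_Integration.integral_add[symmetric])
      (use integrable_times_directional_derivative[OF assms that] in
        \<open>simp_all add: linear_add[OF lin[OF that]] distrib_left\<close>)
  moreover have "(LINT x|lborel. f x * directional_derivative \<phi> (c *\<^sub>R u) x)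
     = c * (LINT x|lborel. f x * directional_derivative \<phi> u x)"
    if "\<phi> \<in> test_functions \<Omega>" for \<phi> c u
    by (simp add: linear_scale[OF lin[OF that]] mult.left_commute)
  ultimately show ?thesis
    by (auto simp: subspace_def weakly_invariant_def linear_0[OF lin])
qed

lemma lborel_integral_translate:
  fixes F :: "'a::euclidean_space \<Rightarrow> real"
  assumes [measurable]: "F \<in> borel_measurable borel"
  shows "(LINT x|lborel. F (x + a)) = (LINT x|lborel. F x)"
proof -
  have "(LINT x|lborel. F x) = (LINT x|distr lborel borel ((+) a). F x)"
    by (simp add: lborel_distr_plus)
  also have "\<dots> = (LINT x|lborel. F (a + x))"
    by (subst integral_distr) auto
  finally show ?thesis by (simp add: add.commute)
qed

lemma AE_lborel_translate:
  fixes a :: "'a::euclidean_space"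
  assumes "AE x in lborel. P x"
  shows "AE x in lborel. P (x + a)"
proof -
  have "AE x in distr lborel borel ((+) a). P x"
    by (subst lborel_distr_plus) (rule assms)
  from AE_distrD[OF _ this] show ?thesis
    by (simp add: add.commute)
qed

lemma translated_pairing:
  assumes [measurable]: "f \<in> borel_measurable borel" and \<phi>: "\<phi> \<in> test_functions U"
  shows "(LINT x|lborel. f (x + a) * \<phi> x) = (LINT x|lborel. f x * \<phi> (x - a))"
proof -
  have [measurable]: "\<phi> \<in> borel_measurable borel"
    by (rule borel_measurable_continuous_onI[OF test_function_continuous_on[OF \<phi>]])
  show ?thesis
    using lborel_integral_translate[of "\<lambda>x. f x * \<phi> (x - a)" a] by simp
qed

text \<open>For a test function \<open>\<psi>\<close> on \<open>U\<close>, the pairing of \<open>f\<close> with the translates \<open>\<psi>(\<cdot> - s v)\<close> has derivative zero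
  in \<open>s\<close>, because each of these translates is a test function on \<open>\<Omega>\<close>. The pairings for \<open>s = 0\<close> and
  \<open>s = 1\<close> therefore agree, and the fundamental lemma applies to \<open>f(x + v) - f(x)\<close>.\<close>

lemma weakly_invariant_imp_translation_invariant:
  assumes [measurable]: "f \<in> borel_measurable borel" and f: "\<And>x. \<bar>f x\<bar> \<le> M"
    and inv: "weakly_invariant \<Omega> u f"
  shows "translation_invariant \<Omega> u f"
  unfolding translation_invariant_def
proof (intro allI impI)
  fix t and U :: "'a set"
  assume U: "open U" and sub: "\<forall>x\<in>U. \<forall>s\<in>{0..1}. x + s *\<^sub>R t *\<^sub>R u \<in> \<Omega>"
  define v where "v = t *\<^sub>R u"
  have v: "weakly_invariant \<Omega> v f"
    using subspace_mul[OF subspace_weakly_invariant[OF assms(1) f]] inv by (auto simp: v_def)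
  have "AE x in lborel. x \<in> U \<longrightarrow> f (x + v) - f x = 0"
  proof (rule AE_eq_0_if_test_integrals_eq_0[OF _ _ U])
    show "\<bar>f (x + v) - f x\<bar> \<le> 2 * M" for x
      using f[of x] f[of "x + v"] by linarith
    fix \<psi> assume \<psi>: "\<psi> \<in> test_functions U"
    define H where "H = (\<lambda>s. LINT x|lborel. f x * \<psi> (x - s *\<^sub>R v))"
    have DH: "(H has_real_derivative - (LINT x|lborel. f x * directional_derivative \<psi> v (x - s *\<^sub>R v))) (at s)" for s
      unfolding H_def by (rule translated_pairing_has_derivative[OF assms(1) f \<psi>])
    have "(H has_real_derivative 0) (at s)" if s: "0 < s" "s < 1" for s
    proof -
      have "(\<lambda>x. \<psi> (x - s *\<^sub>R v)) \<in> test_functions \<Omega>"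
        by (rule test_function_translate[OF \<psi>]) (use sub s in \<open>auto simp: v_def\<close>)
      then have "(LINT x|lborel. f x * directional_derivative \<psi> v (x - s *\<^sub>R v)) = 0"
        using v by (auto simp: weakly_invariant_def directional_derivative_translate[OF \<psi>])
      then show ?thesis using DH[of s] by simp
    qed
    moreover have "continuous_on {0..1} H"
      using DERIV_isCont[OF DH] by (simp add: continuous_at_imp_continuous_on)
    ultimately have "H 1 = H 0"
      by (intro DERIV_isconst_end) auto
    moreover have "integrable lborel (\<lambda>x. f (x + v) * \<psi> x)" "integrable lborel (\<lambda>x. f x * \<psi> x)"
      by (intro integrable_times_test_function[OF _ _ \<psi>, of _ M] f; measurable)+
    moreover have "(LINT x|lborel. f (x + v) * \<psi> x) = H 1"
      using translated_pairing[OF assms(1) \<psi>, of v] by (simp add: H_def)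
    ultimately show "(LINT x|lborel. (f (x + v) - f x) * \<psi> x) = 0"
      by (simp add: left_diff_distrib H_def)
  qed measurable
  then show "AE x in lborel. x \<in> U \<longrightarrow> f (x + t *\<^sub>R u) = f x"
    by (simp add: v_def)
qed

text \<open>Near \<open>t = 0\<close> the pairing of \<open>f\<close> with \<open>\<phi>(\<cdot> - t u)\<close> is constant, since the support of \<open>\<phi>\<close> has positive
  distance from the complement of \<open>\<Omega>\<close>; so its derivative at zero, which is the weak derivative of
  \<open>f\<close> tested with \<open>\<phi>\<close>, vanishes.\<close>

lemma translation_invariant_imp_weakly_invariant:
  assumes [measurable]: "f \<in> borel_measurable borel" and f: "\<And>x. \<bar>f x\<bar> \<le> M"
    and "open \<Omega>" and inv: "translation_invariant \<Omega> u f"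
  shows "weakly_invariant \<Omega> u f"
  unfolding weakly_invariant_def
proof
  fix \<phi> assume \<phi>: "\<phi> \<in> test_functions \<Omega>"
  define S where "S = closure {x. \<phi> x \<noteq> 0}"
  obtain \<delta> where \<delta>: "\<delta> > 0" "(\<Union>x\<in>S. ball x \<delta>) \<subseteq> \<Omega>"
    using compact_subset_open_imp_ball_epsilon_subset[OF test_function_support(1)[OF \<phi>] \<open>open \<Omega>\<close>
        test_function_support(2)[OF \<phi>]] unfolding S_def by metis
  define U where "U = (\<Union>x\<in>S. ball x (\<delta> / 2))"
  \<comment> \<open>The summand 1 only prevents a division by zero when \<open>u = 0\<close>.\<close>
  define T where "T = ball (0::real) (\<delta> / (2 * (norm u + 1)))"
  define H where "H = (\<lambda>t. LINT x|lborel. f x * \<phi> (x - t *\<^sub>R u))"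
  have "H 0 = H t" if "t \<in> T" for t
  proof -
    have "norm (t *\<^sub>R u) \<le> \<bar>t\<bar> * (norm u + 1)" by (simp add: mult_left_mono)
    also have "\<dots> < \<delta> / 2"
      using that by (simp add: T_def field_simps add_pos_nonneg)
    finally have t: "norm (t *\<^sub>R u) < \<delta> / 2" .
    have "y + s *\<^sub>R t *\<^sub>R u \<in> \<Omega>" if y: "y \<in> U" and s: "s \<in> {0..1}" for y s
    proof -
      obtain x where x: "x \<in> S" "dist x y < \<delta> / 2" using y by (auto simp: U_def)
      have "norm (s *\<^sub>R t *\<^sub>R u) \<le> norm (t *\<^sub>R u)"
        using s by (simp add: abs_mult mult_left_le_one_le mult.assoc)
      then have "dist y (y + s *\<^sub>R t *\<^sub>R u) < \<delta> / 2"
        using t by (simp add: dist_norm)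
      then have "y + s *\<^sub>R t *\<^sub>R u \<in> ball x \<delta>"
        using x dist_triangle[of x "y + s *\<^sub>R t *\<^sub>R u" y] by simp
      then show ?thesis using x \<delta> by blast
    qed
    moreover have "open U" by (auto simp: U_def)
    ultimately have "AE x in lborel. x \<in> U \<longrightarrow> f (x + t *\<^sub>R u) = f x"
      using inv by (auto simp: translation_invariant_def)
    moreover have "\<phi> x = 0" if "x \<notin> U" for x
      using that \<delta> test_function_eq_0[of x \<phi>] by (force simp: U_def S_def)
    ultimately have "AE x in lborel. f (x + t *\<^sub>R u) * \<phi> x = f x * \<phi> x"
      by (elim eventually_mono) (metis mult_zero_right)
    moreover have [measurable]: "\<phi> \<in> borel_measurable borel"
      by (rule borel_measurable_continuous_onI[OF test_function_continuous_on[OF \<phi>]])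
    ultimately have "(LINT x|lborel. f (x + t *\<^sub>R u) * \<phi> x) = (LINT x|lborel. f x * \<phi> x)"
      by (intro integral_cong_AE) auto
    then show ?thesis
      using translated_pairing[OF assms(1) \<phi>, of "t *\<^sub>R u"] by (simp add: H_def)
  qed
  moreover have "0 \<in> T" using \<delta> by (auto simp: T_def add_nonneg_pos)
  moreover have "open T" by (simp add: T_def)
  ultimately have "(H has_real_derivative 0) (at 0)"
    by (intro has_field_derivative_transform_within_open[OF DERIV_const[of "H 0"], of T])
  moreover have "(H has_real_derivative - (LINT x|lborel. f x * directional_derivative \<phi> u (x - 0 *\<^sub>R u))) (at 0)"
    unfolding H_def by (rule translated_pairing_has_derivative[OF assms(1) f \<phi>])
  ultimately show "(LINT x|lborel. f x * directional_derivative \<phi> u x) = 0"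
    using DERIV_unique by fastforce
qed

lemma translation_invariant_compose:
  "translation_invariant \<Omega> u f \<Longrightarrow> translation_invariant \<Omega> u (\<lambda>x. g (f x))"
  unfolding translation_invariant_def by (fast elim!: eventually_mono intro: arg_cong[where f = g])

text \<open>This is how information on a few components of a field spreads to the whole field: a point of \<open>K\<close> is
  recovered from its values under the family \<open>L\<close>, possibly by a nonlinear and discontinuous
  rule, so that only the pointwise form of invariance can be transferred.\<close>

lemma translation_invariant_if_separating:
  assumes "finite I" and FK: "AE x in lborel. x \<in> \<Omega> \<longrightarrow> F x \<in> K"
    and inv: "\<And>i. i \<in> I \<Longrightarrow> translation_invariant \<Omega> u (\<lambda>x. L i (F x))"
    and sep: "\<And>A A'. A \<in> K \<Longrightarrow> A' \<in> K \<Longrightarrow> (\<And>i. i \<in> I \<Longrightarrow> L i A = L i A') \<Longrightarrow> A = A'"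
  shows "translation_invariant \<Omega> u F"
  unfolding translation_invariant_def
proof (intro allI impI)
  fix t U
  assume U: "open U" and sub: "\<forall>x\<in>U. \<forall>s\<in>{0..1}. x + s *\<^sub>R t *\<^sub>R u \<in> \<Omega>"
  have "AE x in lborel. \<forall>i\<in>I. x \<in> U \<longrightarrow> L i (F (x + t *\<^sub>R u)) = L i (F x)"
    using inv U sub \<open>finite I\<close>
    by (subst AE_finite_all) (auto simp: translation_invariant_def)
  moreover have "AE x in lborel. x + t *\<^sub>R u \<in> \<Omega> \<longrightarrow> F (x + t *\<^sub>R u) \<in> K"
    by (rule AE_lborel_translate[OF FK])
  ultimately show "AE x in lborel. x \<in> U \<longrightarrow> F (x + t *\<^sub>R u) = F x"
    using FK
  proof eventually_elim
    case (elim x)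
    show ?case
    proof
      assume x: "x \<in> U"
      then have "x \<in> \<Omega>" "x + t *\<^sub>R u \<in> \<Omega>"
        using bspec[OF bspec[OF sub x], of 0] bspec[OF bspec[OF sub x], of 1] by auto
      with elim x show "F (x + t *\<^sub>R u) = F x" by (intro sep) auto
    qed
  qed
qed

section \<open>Functions invariant along all directions\<close>

lemma AE_lborel_witness:
  assumes "AE x in lborel. P x" "open U" "U \<noteq> {}"
  shows "\<exists>x\<in>U. P x"
proof (rule ccontr)
  assume "\<not> ?thesis"
  then have "AE x in lborel. x \<notin> U" using assms(1) by (auto elim: eventually_mono)
  then have "U \<in> null_sets lborel" using assms(2) by (subst AE_iff_null_sets) auto
  then have "negligible U" by (simp add: negligible_iff_null_sets null_sets_completionI)
  then show False using open_not_negligible assms by blast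
qed

text \<open>For each small \<open>h\<close>, the identity \<open>F(x + h) = F(x)\<close> holds for almost every \<open>x\<close> in the ball. By Fubini
  some \<open>x0\<close> in the ball satisfies it for almost every \<open>h\<close>, and \<open>x0 + h\<close> then sweeps out the ball.\<close>

lemma translation_invariant_imp_locally_constant:
  fixes F :: "'a::euclidean_space \<Rightarrow> 'b::euclidean_space"
  assumes [measurable]: "F \<in> borel_measurable borel" and "0 < r" and sub: "ball a (3 * r) \<subseteq> \<Omega>"
    and inv: "\<And>u. translation_invariant \<Omega> u F"
  shows "\<exists>c. AE x in lborel. x \<in> ball a r \<longrightarrow> F x = c"
proof -
  let ?P = "\<lambda>h x. norm h < 2 * r \<and> x \<in> ball a r \<longrightarrow> F (x + h) = F x"
  have "AE x in lborel. ?P h x" for h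
  proof (cases "norm h < 2 * r")
    case True
    have "x + s *\<^sub>R 1 *\<^sub>R h \<in> \<Omega>" if x: "x \<in> ball a r" and s: "s \<in> {0..1}" for x s
    proof -
      have "norm (s *\<^sub>R h) \<le> norm h"
        using s mult_left_le_one_le[of "norm h" s] by simp
      moreover have "dist a (x + s *\<^sub>R h) \<le> dist a x + norm (s *\<^sub>R h)"
        by (metis add_diff_cancel_left' dist_norm dist_triangle norm_minus_commute)
      ultimately have "dist a (x + s *\<^sub>R h) < 3 * r"
        using True x by simp
      then show ?thesis using sub by auto
    qed
    then have "AE x in lborel. x \<in> ball a r \<longrightarrow> F (x + 1 *\<^sub>R h) = F x"
      using inv[of h] unfolding translation_invariant_def by blast
    then show ?thesis by (auto elim: eventually_mono)
  qed simp
  then have "AE h in lborel. AE x in lborel. ?P h x" by simp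
  moreover have "{z \<in> space (lborel \<Otimes>\<^sub>M lborel). ?P (fst z) (snd z)} \<in> sets (lborel \<Otimes>\<^sub>M lborel)"
  proof -
    \<comment> \<open>Equality is written as zero distance so that the measurability prover can treat it.\<close>
    have "Measurable.pred (lborel \<Otimes>\<^sub>M lborel) (\<lambda>z. norm (fst z) < 2 * r \<and> dist a (snd z) < r \<longrightarrow>
        dist (F (snd z + fst z)) (F (snd z)) = 0)"
      by measurable
    then show ?thesis by (simp add: pred_def)
  qed
  ultimately have "AE x in lborel. AE h in lborel. ?P h x"
    using lborel_pair.AE_commute[of ?P] by blast
  from AE_lborel_witness[OF this, of "ball a r"]
  obtain x0 where x0: "x0 \<in> ball a r" "AE h in lborel. ?P h x0"
    using \<open>0 < r\<close> by auto
  have "AE y in lborel. ?P (y + - x0) x0"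
    by (rule AE_lborel_translate[OF x0(2)])
  then have "AE y in lborel. y \<in> ball a r \<longrightarrow> F y = F x0"
  proof eventually_elim
    case (elim y)
    show ?case
    proof
      assume "y \<in> ball a r"
      then have "dist y x0 < 2 * r"
        using x0(1) dist_triangle[of y x0 a] by (simp add: dist_commute)
      then have "norm (y + - x0) < 2 * r"
        by (simp add: dist_norm)
      then have "F (x0 + (y + - x0)) = F x0"
        using elim x0(1) by blast
      then show "F y = F x0" by simp
    qed
  qed
  then show ?thesis by blast
qed

text \<open>The local constants agree on overlapping balls, so they form a locally constant function of the
  centre; countably many balls suffice to cover \<open>\<Omega>\<close>.\<close>

lemma translation_invariant_imp_constant:
  fixes F :: "'a::euclidean_space \<Rightarrow> 'b::euclidean_space"
  assumes F: "F \<in> borel_measurable borel" and "open \<Omega>" "connected \<Omega>"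
    and inv: "\<And>u. translation_invariant \<Omega> u F"
  shows "\<exists>c. AE x in lborel. x \<in> \<Omega> \<longrightarrow> F x = c"
proof -
  have "\<exists>r c. 0 < r \<and> ball a r \<subseteq> \<Omega> \<and> (AE x in lborel. x \<in> ball a r \<longrightarrow> F x = c)" if a: "a \<in> \<Omega>" for a
  proof -
    obtain e where e: "e > 0" "ball a e \<subseteq> \<Omega>"
      by (rule openE[OF \<open>open \<Omega>\<close> a])
    then have "0 < e / 3" "ball a (3 * (e / 3)) \<subseteq> \<Omega>" "ball a (e / 3) \<subseteq> \<Omega>"
      using subset_ball[of "e / 3" e a] by auto
    then show ?thesis
      using translation_invariant_imp_locally_constant[OF F _ _ inv, of "e / 3" a] by blast
  qed
  then obtain r c where rc: "\<And>a. a \<in> \<Omega> \<Longrightarrow> 0 < r a \<and> ball a (r a) \<subseteq> \<Omega> \<and>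
      (AE x in lborel. x \<in> ball a (r a) \<longrightarrow> F x = c a)"
    by metis
  have c_eq: "c b = c a" if a: "a \<in> \<Omega>" and b: "b \<in> ball a (r a)" for a b
  proof -
    have b': "b \<in> \<Omega>" using a b rc by blast
    have "AE x in lborel. (x \<in> ball a (r a) \<longrightarrow> F x = c a) \<and> (x \<in> ball b (r b) \<longrightarrow> F x = c b)"
      using rc[OF a] rc[OF b'] by (auto intro: eventually_conj)
    moreover have "b \<in> ball a (r a) \<inter> ball b (r b)" using b rc[OF b'] by simp
    ultimately show ?thesis
      using AE_lborel_witness[of _ "ball a (r a) \<inter> ball b (r b)"] by fastforce
  qed
  have "c constant_on \<Omega>"
  proof (rule locally_constant_imp_constant[OF \<open>connected \<Omega>\<close>])
    fix a assume a: "a \<in> \<Omega>"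
    have "openin (top_of_set \<Omega>) (ball a (r a))"
      using rc[OF a] \<open>open \<Omega>\<close> by (simp add: openin_open_eq)
    moreover have "a \<in> ball a (r a)" using rc[OF a] by simp
    ultimately show "\<exists>T. openin (top_of_set \<Omega>) T \<and> a \<in> T \<and> (\<forall>x\<in>T. c x = c a)"
      using c_eq[OF a] by blast
  qed
  then obtain C where C: "\<And>a. a \<in> \<Omega> \<Longrightarrow> c a = C" by (auto simp: constant_on_def)
  define \<F> where "\<F> = (\<lambda>a. ball a (r a)) ` \<Omega>"
  obtain \<F>' where \<F>': "\<F>' \<subseteq> \<F>" "countable \<F>'" "\<Union>\<F>' = \<Union>\<F>"
    by (rule Lindelof[of \<F>]) (auto simp: \<F>_def)
  have "AE x in lborel. x \<in> S \<longrightarrow> F x = C" if S: "S \<in> \<F>'" for S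
  proof -
    obtain a where a: "a \<in> \<Omega>" "S = ball a (r a)"
      using \<F>'(1) S by (auto simp: \<F>_def)
    with rc[OF a(1)] C[OF a(1)] show ?thesis by simp
  qed
  then have "AE x in lborel. \<forall>S\<in>\<F>'. x \<in> S \<longrightarrow> F x = C"
    using \<F>'(2) by (subst AE_ball_countable) auto
  moreover have "\<Omega> \<subseteq> \<Union>\<F>"
    unfolding \<F>_def using rc centre_in_ball by blast
  ultimately have "AE x in lborel. x \<in> \<Omega> \<longrightarrow> F x = C"
    using \<F>' by (auto elim!: eventually_mono)
  then show ?thesis by blast
qed


section \<open>Linear algebra\<close>

lemma span_insert_normal:
  fixes \<pi> :: "'a::euclidean_space set"
  assumes \<pi>: "subspace \<pi>" "dim \<pi> = DIM('a) - 1" and v: "v \<noteq> 0" "\<And>x. x \<in> \<pi> \<Longrightarrow> orthogonal v x"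
  shows "span (insert v \<pi>) = UNIV"
proof -
  have "v \<notin> span \<pi>"
    using v \<pi>(1) by (metis orthogonal_self span_eq_iff)
  then have "dim (insert v \<pi>) = DIM('a)"
    using \<pi>(2) DIM_positive[where 'a='a] by (simp add: dim_insert)
  then show ?thesis by (simp add: dim_eq_full)
qed

lemma orthogonal_hyperplane_multiple:
  fixes \<pi> :: "'a::euclidean_space set"
  assumes \<pi>: "subspace \<pi>" "dim \<pi> = DIM('a) - 1" and v: "norm v = 1" "\<And>x. x \<in> \<pi> \<Longrightarrow> orthogonal v x"
    and p: "\<And>x. x \<in> \<pi> \<Longrightarrow> orthogonal p x"
  shows "p = (p \<bullet> v) *\<^sub>R v"
proof -
  let ?z = "p - (p \<bullet> v) *\<^sub>R v"
  have "orthogonal ?z x" if "x \<in> insert v \<pi>" for x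
    using that v p by (auto simp: orthogonal_def inner_diff_left norm_eq_1)
  moreover have "?z \<in> span (insert v \<pi>)"
    using span_insert_normal[OF \<pi> _ v(2)] v(1) by (metis UNIV_I norm_zero zero_neq_one)
  ultimately have "orthogonal ?z ?z"
    by (metis orthogonal_to_span)
  then show ?thesis by (simp add: orthogonal_self)
qed

lemma vector_matrix_mult_sum_row:
  fixes A :: "real^'n^'m"
  shows "w v* A = (\<Sum>i\<in>UNIV. (w $ i) *\<^sub>R row i A)"
  by (simp add: vec_eq_iff vector_matrix_mult_def row_def mult.commute)

lemma row_inner: "row i (A :: real^'n^'m) \<bullet> x = (A *v x) $ i"
  by (simp add: row_def inner_vec_def matrix_vector_mult_def)

text \<open>If all these values agreed, then \<open>A - A'\<close> would map the normal \<open>v\<close> into \<open>\<tau>\<close>. It also maps \<open>\<pi>\<close> into \<open>\<tau>\<close>,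
  so its whole range would lie in a space of dimension smaller than its rank.\<close>

lemma normal_image_separates:
  fixes A A' :: "real^'n^'m"
  assumes rank: "rank (A - A') = CARD('n)"
    and \<pi>: "subspace \<pi>" "dim \<pi> = CARD('n) - 1" and v: "norm v = 1" "\<And>x. x \<in> \<pi> \<Longrightarrow> orthogonal v x"
    and \<tau>: "subspace \<tau>" "dim \<tau> = CARD('n) - 1"
    and A: "(\<lambda>x. A *v x) ` \<pi> \<subseteq> \<tau>" "(\<lambda>x. A' *v x) ` \<pi> \<subseteq> \<tau>"
    and W: "orthogonal_comp \<tau> \<subseteq> span W"
  shows "\<exists>w\<in>W. w \<bullet> (A *v v) \<noteq> w \<bullet> (A' *v v)"
proof (rule ccontr)
  assume "\<not> ?thesis"
  then have "orthogonal ((A - A') *v v) w" if "w \<in> W" for w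
    using that by (auto simp: orthogonal_def matrix_vector_mult_diff_rdistrib inner_diff_right inner_commute[of _ w])
  then have "orthogonal ((A - A') *v v) w" if "w \<in> orthogonal_comp \<tau>" for w
    using that W orthogonal_to_span by blast
  then have "(A - A') *v v \<in> orthogonal_comp (orthogonal_comp \<tau>)"
    by (subst orthogonal_comp_def) (auto simp: orthogonal_commute)
  then have "(A - A') *v v \<in> \<tau>"
    by (simp add: orthogonal_comp_self[OF \<tau>(1)])
  moreover have "(A - A') *v x \<in> \<tau>" if "x \<in> \<pi>" for x
    using that A \<tau>(1) by (auto simp: matrix_vector_mult_diff_rdistrib image_subset_iff intro: subspace_diff)
  ultimately have "(\<lambda>x. (A - A') *v x) ` insert v \<pi> \<subseteq> \<tau>" by auto
  then have "span ((\<lambda>x. (A - A') *v x) ` insert v \<pi>) \<subseteq> \<tau>"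
    using \<tau>(1) by (simp add: span_minimal)
  moreover have "span ((\<lambda>x. (A - A') *v x) ` insert v \<pi>) = range (\<lambda>x. (A - A') *v x)"
  proof -
    have "v \<noteq> 0" using v(1) by auto
    then have "span (insert v \<pi>) = UNIV"
      using \<pi> v(2) by (intro span_insert_normal) auto
    then show ?thesis by (subst linear_span_image) auto
  qed
  ultimately have "rank (A - A') \<le> CARD('n) - 1"
    by (metis rank_dim_range dim_subset \<tau>(2))
  moreover have "0 < CARD('n)" by simp
  ultimately show False using rank by linarith
qed

section \<open>Rigidity of Borel fields\<close>

text \<open>It turns the divergence condition for a row \<open>b\<close> into the vanishing of the integral of \<open>D\<phi>(b)\<close>.\<close>

lemma inner_gradient:
  assumes "\<phi> \<in> test_functions \<Omega>"
  shows "w \<bullet> gradient \<phi> x = directional_derivative \<phi> w x"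
proof -
  have lin: "linear (frechet_derivative \<phi> (at x))"
    using test_function_has_derivative[OF assms] has_derivative_linear by blast
  have "frechet_derivative \<phi> (at x) w = frechet_derivative \<phi> (at x) (\<Sum>i\<in>UNIV. (w $ i) *\<^sub>R axis i 1)"
    using basis_expansion[of w] by (simp add: scalar_mult_eq_scaleR)
  also have "\<dots> = (\<Sum>i\<in>UNIV. (w $ i) * frechet_derivative \<phi> (at x) (axis i 1))"
    by (simp add: linear_sum[OF lin] linear_scale[OF lin])
  finally show ?thesis by (simp add: gradient_def inner_vec_def)
qed

lemma bounded_linear_image_bounded:
  fixes F :: "'a \<Rightarrow> 'b::euclidean_space"
  assumes "\<And>x. norm (F x) \<le> M" "linear L"
  shows "\<exists>M'. \<forall>x. \<bar>L (F x) :: real\<bar> \<le> M'"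
proof -
  obtain C where C: "0 < C" "\<And>y. norm (L y) \<le> C * norm y"
    using linear_bounded_pos[OF assms(2)] by blast
  have "\<bar>L (F x)\<bar> \<le> C * M" for x
    using order_trans[OF C(2)[of "F x"] mult_left_mono[OF assms(1)[of x]]] C(1) by simp
  then show ?thesis by blast
qed

text \<open>Invariance is established along the normals first, then along the direction orthogonal to all of
  them, where the first step is used to discard all other derivatives in the divergence. The integrand
  in the divergence condition is \<open>\<langle>row i (F x), \<nabla>\<phi> x\<rangle>\<close>, by \<open>inner_gradient\<close>.\<close>

lemma borel_field_constant:
  fixes \<Omega> :: "(real^'n) set" and K :: "(real^'n^'m) set"
    and \<pi> :: "'i \<Rightarrow> (real^'n) set" and \<tau> :: "'i \<Rightarrow> (real^'m) set"
    and F :: "real^'n \<Rightarrow> real^'n^'m"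
  assumes \<Omega>: "open \<Omega>" "connected \<Omega>"
    and rank: "\<And>A A'. A \<in> K \<Longrightarrow> A' \<in> K \<Longrightarrow> A \<noteq> A' \<Longrightarrow> rank (A - A') = CARD('n)"
    and I: "finite I" "card I = CARD('n) - 1"
    and \<pi>: "\<And>r. r \<in> I \<Longrightarrow> subspace (\<pi> r) \<and> dim (\<pi> r) = CARD('n) - 1"
    and ind: "independent_hyperplanes I \<pi>"
    and \<tau>: "\<And>r. r \<in> I \<Longrightarrow> subspace (\<tau> r) \<and> dim (\<tau> r) = CARD('n) - 1"
    and K\<pi>: "\<And>A r. A \<in> K \<Longrightarrow> r \<in> I \<Longrightarrow> (\<lambda>x. A *v x) ` \<pi> r \<subseteq> \<tau> r"
    and F[measurable]: "F \<in> borel_measurable borel" and bnd: "\<And>x. norm (F x) \<le> M"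
    and FK: "AE x in lborel. x \<in> \<Omega> \<longrightarrow> F x \<in> K"
    and div: "\<And>i \<phi>. \<phi> \<in> test_functions \<Omega> \<Longrightarrow>
      (LINT x|lborel. directional_derivative \<phi> (row i (F x)) x) = 0"
  shows "\<exists>C. AE x in lborel. x \<in> \<Omega> \<longrightarrow> F x = C"
proof -
  obtain v where v: "\<And>r. r \<in> I \<Longrightarrow> norm (v r) = 1" "\<And>r x. r \<in> I \<Longrightarrow> x \<in> \<pi> r \<Longrightarrow> orthogonal (v r) x"
    "inj_on v I" "independent (v ` I)"
    using ind unfolding independent_hyperplanes_def by blast
  have lin: "linear (frechet_derivative \<phi> (at x))" if "\<phi> \<in> test_functions \<Omega>" for \<phi> x
    using test_function_has_derivative[OF that] has_derivative_linear by blast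
  have meas: "(\<lambda>x. L (F x) :: real) \<in> borel_measurable borel" if "linear L" for L
    by (rule measurable_compose[OF F borel_measurable_continuous_onI[OF linear_continuous_on[OF
        linear_conv_bounded_linear[THEN iffD1, OF that]]]])
  have to_translation: "translation_invariant \<Omega> u (\<lambda>x. L (F x))"
    if "linear L" "weakly_invariant \<Omega> u (\<lambda>x. L (F x))" for L u
    using bounded_linear_image_bounded[of F M L, OF bnd that(1)]
      weakly_invariant_imp_translation_invariant[OF meas[OF that(1)] _ that(2)] by blast
  have to_weak: "weakly_invariant \<Omega> u (\<lambda>x. L (F x))"
    if "linear L" "translation_invariant \<Omega> u F" for L u
    using bounded_linear_image_bounded[of F M L, OF bnd that(1)]
      translation_invariant_imp_weakly_invariant[OF meas[OF that(1)] _ \<Omega>(1)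
        translation_invariant_compose[OF that(2)]] by blast
  have sub: "subspace {u. weakly_invariant \<Omega> u (\<lambda>x. L (F x))}" if "linear L" for L
    using bounded_linear_image_bounded[of F M L, OF bnd that]
      subspace_weakly_invariant[OF meas[OF that]] by blast
  have int: "integrable lborel (\<lambda>x. L (F x) * directional_derivative \<phi> u x)"
    if "linear L" "\<phi> \<in> test_functions \<Omega>" for L \<phi> u
    using bounded_linear_image_bounded[of F M L, OF bnd that(1)]
      integrable_times_directional_derivative[OF meas[OF that(1)] _ that(2)] by blast
  have lin_entry: "linear (\<lambda>A::real^'n^'m. A $ i $ j)" for i j
    by (rule linearI) auto
  have lin_row: "linear (\<lambda>A::real^'n^'m. row i A \<bullet> e)" for i e
    by (rule linearI) (auto simp: row_inner matrix_vector_mult_add_rdistrib scaleR_matrix_vector_assoc[symmetric])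
  have lin_w: "linear (\<lambda>A::real^'n^'m. w \<bullet> (A *v y))" for w y
    by (rule linearI) (auto simp: matrix_vector_mult_add_rdistrib inner_add_right scaleR_matrix_vector_assoc[symmetric])
  have dd_row: "directional_derivative \<phi> (row i (F x)) x = (\<Sum>j\<in>UNIV. F x $ i $ j * directional_derivative \<phi> (axis j 1) x)"
    if "\<phi> \<in> test_functions \<Omega>" for \<phi> x i
    using inner_gradient[OF that, of "row i (F x)" x, symmetric]
    by (simp add: inner_vec_def row_def gradient_def)
  have int_row: "integrable lborel (\<lambda>x. directional_derivative \<phi> (row i (F x)) x)" if "\<phi> \<in> test_functions \<Omega>" for \<phi> i
    unfolding dd_row[OF that] by (intro Bochner_Integration.integrable_sum int[OF lin_entry that])

  have inv_v: "translation_invariant \<Omega> (v r) F" if r: "r \<in> I" for r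
  proof -
    note \<pi>r = \<pi>[OF r, THEN conjunct1] \<pi>[OF r, THEN conjunct2]
    note \<tau>r = \<tau>[OF r, THEN conjunct1] \<tau>[OF r, THEN conjunct2]
    obtain W where W: "finite W" "W \<subseteq> orthogonal_comp (\<tau> r)" "orthogonal_comp (\<tau> r) \<subseteq> span W"
      by (metis basis_exists finiteI_independent)
    have "weakly_invariant \<Omega> (v r) (\<lambda>x. w \<bullet> (F x *v v r))" if w: "w \<in> W" for w
      unfolding weakly_invariant_def
    proof
      fix \<phi> assume \<phi>: "\<phi> \<in> test_functions \<Omega>"
      \<comment> \<open>The row combination \<open>w\<^sup>T A\<close> annihilates \<open>\<pi> r\<close>, hence is a multiple of the normal.\<close>
      have wA: "w v* A = (w \<bullet> (A *v v r)) *\<^sub>R v r" if A: "A \<in> K" for A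
      proof -
        have "orthogonal (w v* A) x" if "x \<in> \<pi> r" for x
          using W(2) w K\<pi>[OF A r] that
          by (auto simp: orthogonal_def dot_lmul_matrix orthogonal_comp_def inner_commute[of w])
        then have "w v* A = ((w v* A) \<bullet> v r) *\<^sub>R v r"
          using \<pi>r v(1,2)[OF r] by (intro orthogonal_hyperplane_multiple) auto
        then show ?thesis by (simp add: dot_lmul_matrix)
      qed
      \<comment> \<open>So \<open>w\<^sup>T F\<close> is a divergence-free field of constant direction \<open>v r\<close>: its coefficient has
         vanishing derivative along \<open>v r\<close>.\<close>
      have "AE x in lborel. w \<bullet> (F x *v v r) * directional_derivative \<phi> (v r) x
          = (\<Sum>i\<in>UNIV. w $ i * directional_derivative \<phi> (row i (F x)) x)"
        using FK
      proof eventually_elim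
        case (elim x)
        show ?case
        proof (cases "x \<in> \<Omega>")
          case True
          then have "directional_derivative \<phi> (w v* F x) x = w \<bullet> (F x *v v r) * directional_derivative \<phi> (v r) x"
            using elim by (simp add: wA linear_scale[OF lin[OF \<phi>]])
          then show ?thesis
            by (simp add: vector_matrix_mult_sum_row linear_sum[OF lin[OF \<phi>]] linear_scale[OF lin[OF \<phi>]])
        next
          case False
          then have "directional_derivative \<phi> u x = 0" for u
            using test_function_support(2)[OF \<phi>] by (intro directional_derivative_eq_0) auto
          then show ?thesis by simp
        qed
      qed
      then have "(LINT x|lborel. w \<bullet> (F x *v v r) * directional_derivative \<phi> (v r) x)
          = (LINT x|lborel. (\<Sum>i\<in>UNIV. w $ i * directional_derivative \<phi> (row i (F x)) x))"
        by (intro integral_cong_AE borel_measurable_integrable int[OF lin_w \<phi>]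
            Bochner_Integration.integrable_sum integrable_mult_right int_row[OF \<phi>])
      also have "\<dots> = (\<Sum>i\<in>UNIV. w $ i * (LINT x|lborel. directional_derivative \<phi> (row i (F x)) x))"
        using int_row[OF \<phi>] by (subst Bochner_Integration.integral_sum) auto
      finally show "(LINT x|lborel. w \<bullet> (F x *v v r) * directional_derivative \<phi> (v r) x) = 0"
        using div[OF \<phi>] by simp
    qed
    then have "translation_invariant \<Omega> (v r) (\<lambda>x. w \<bullet> (F x *v v r))" if "w \<in> W" for w
      using that by (intro to_translation lin_w)
    then show ?thesis
    proof (rule translation_invariant_if_separating[OF W(1) FK])
      fix A A' assume A: "A \<in> K" "A' \<in> K" and eq: "\<And>w. w \<in> W \<Longrightarrow> w \<bullet> (A *v v r) = w \<bullet> (A' *v v r)"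
      show "A = A'"
      proof (rule ccontr)
        assume "A \<noteq> A'"
        from normal_image_separates[OF rank[OF A this] \<pi>r v(1)[OF r] v(2)[OF r] \<tau>r
            K\<pi>[OF A(1) r] K\<pi>[OF A(2) r] W(3)] eq
        show False by blast
      qed
    qed
  qed

  \<comment> \<open>The one direction \<open>e\<close> that is left is the common line of the hyperplanes; its orthogonal
     complement is spanned by the normals.\<close>
  have "dim (v ` I) = CARD('n) - 1"
    using v(3,4) I by (simp add: dim_eq_card_independent card_image)
  moreover have "0 < CARD('n)" by simp
  ultimately have "dim (v ` I) < DIM(real^'n)" by simp
  then obtain e where e: "e \<noteq> 0" "\<And>y. y \<in> span (v ` I) \<Longrightarrow> orthogonal e y"
    using orthogonal_to_subspace_exists[of "v ` I"] by metis
  have perp: "{y. e \<bullet> y = 0} = span (v ` I)"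
  proof (rule sym, rule subspace_dim_equal)
    show "span (v ` I) \<subseteq> {y. e \<bullet> y = 0}" using e(2) by (auto simp: orthogonal_def)
    show "dim {y. e \<bullet> y = 0} \<le> dim (span (v ` I))"
      using dim_hyperplane[OF e(1)] \<open>dim (v ` I) = _\<close> by (simp add: dim_span)
  qed (auto simp: subspace_hyperplane)
  have weak_perp: "weakly_invariant \<Omega> u (\<lambda>x. L (F x))" if "linear L" "e \<bullet> u = 0" for L u
  proof -
    have "v ` I \<subseteq> {u. weakly_invariant \<Omega> u (\<lambda>x. L (F x))}"
      using inv_v to_weak[OF that(1)] by auto
    then have "span (v ` I) \<subseteq> {u. weakly_invariant \<Omega> u (\<lambda>x. L (F x))}"
      using sub[OF that(1)] by (rule span_minimal)
    then show ?thesis using that(2) perp by auto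
  qed
  define \<epsilon> where "\<epsilon> = (1 / norm e) *\<^sub>R e"
  have \<epsilon>: "\<epsilon> \<bullet> \<epsilon> = 1" "\<epsilon> \<noteq> 0" using e(1) by (auto simp: \<epsilon>_def dot_square_norm power2_eq_square)
  have weak_perp\<epsilon>: "weakly_invariant \<Omega> u (\<lambda>x. L (F x))" if "linear L" "\<epsilon> \<bullet> u = 0" for L u
    using weak_perp[OF that(1), of u] that(2) e(1) by (simp add: \<epsilon>_def)

  have "translation_invariant \<Omega> \<epsilon> (\<lambda>x. row i (F x) \<bullet> \<epsilon>)" for i
  proof (intro to_translation lin_row)
    define p where "p j = axis j 1 - (axis j 1 \<bullet> \<epsilon>) *\<^sub>R \<epsilon>" for j :: 'n
    have p: "\<epsilon> \<bullet> p j = 0" for j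
      using \<epsilon> by (simp add: p_def inner_diff_right inner_commute)
    show "weakly_invariant \<Omega> \<epsilon> (\<lambda>x. row i (F x) \<bullet> \<epsilon>)"
      unfolding weakly_invariant_def
    proof
      fix \<phi> assume \<phi>: "\<phi> \<in> test_functions \<Omega>"
      \<comment> \<open>Splitting each row into its part along \<open>\<epsilon>\<close> and a part orthogonal to \<open>\<epsilon>\<close>; the entries of
         \<open>F\<close> have vanishing derivatives along all \<open>p j\<close>, so only the former part contributes to the
         divergence.\<close>
      have split: "directional_derivative \<phi> (row i (F x)) x = (row i (F x) \<bullet> \<epsilon>) * directional_derivative \<phi> \<epsilon> x
          + (\<Sum>j\<in>UNIV. F x $ i $ j * directional_derivative \<phi> (p j) x)" for x
      proof -
        have "directional_derivative \<phi> (axis j 1) x = directional_derivative \<phi> (p j) x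
            + \<epsilon> $ j * directional_derivative \<phi> \<epsilon> x" for j
          by (simp add: p_def linear_diff[OF lin[OF \<phi>]] linear_scale[OF lin[OF \<phi>]] inner_axis')
        then show ?thesis
          by (subst dd_row[OF \<phi>]) (simp add: distrib_left sum.distrib inner_vec_def row_def sum_distrib_right mult.assoc)
      qed
      have "(LINT x|lborel. F x $ i $ j * directional_derivative \<phi> (p j) x) = 0" for j
        using weak_perp\<epsilon>[OF lin_entry p] \<phi> by (simp add: weakly_invariant_def)
      then have "(LINT x|lborel. (\<Sum>j\<in>UNIV. F x $ i $ j * directional_derivative \<phi> (p j) x)) = 0"
        by (subst Bochner_Integration.integral_sum) (auto intro: int[OF lin_entry \<phi>])
      moreover have "(LINT x|lborel. directional_derivative \<phi> (row i (F x)) x) =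
          (LINT x|lborel. (row i (F x) \<bullet> \<epsilon>) * directional_derivative \<phi> \<epsilon> x)
          + (LINT x|lborel. (\<Sum>j\<in>UNIV. F x $ i $ j * directional_derivative \<phi> (p j) x))"
        unfolding split
        by (intro Bochner_Integration.integral_add Bochner_Integration.integrable_sum
            int[OF lin_entry \<phi>] int[OF lin_row \<phi>])
      ultimately show "(LINT x|lborel. (row i (F x) \<bullet> \<epsilon>) * directional_derivative \<phi> \<epsilon> x) = 0"
        using div[OF \<phi>] by simp
    qed
  qed
  then have inv_\<epsilon>: "translation_invariant \<Omega> \<epsilon> F"
  proof (rule translation_invariant_if_separating[OF finite_class.finite_UNIV FK])
    fix A A' assume A: "A \<in> K" "A' \<in> K" and eq: "\<And>i. i \<in> UNIV \<Longrightarrow> row i A \<bullet> \<epsilon> = row i A' \<bullet> \<epsilon>"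
    \<comment> \<open>Full rank makes \<open>A - A'\<close> injective, so the image of \<open>\<epsilon>\<close> alone determines the matrix.\<close>
    have "(A - A') *v \<epsilon> = (A - A') *v 0"
      using eq by (simp add: row_inner vec_eq_iff matrix_vector_mult_diff_rdistrib)
    then show "A = A'"
      using \<epsilon>(2) rank[OF A] full_rank_injective[of "A - A'"] by (metis injD)
  qed

  have "translation_invariant \<Omega> u F" for u
  proof (rule translation_invariant_if_separating[OF finite_Basis FK])
    fix b :: "real^'n^'m" assume "b \<in> Basis"
    have L: "linear (\<lambda>A. A \<bullet> b)" by (simp add: linear_iff inner_add_left)
    have "weakly_invariant \<Omega> (u - (u \<bullet> \<epsilon>) *\<^sub>R \<epsilon>) (\<lambda>x. F x \<bullet> b)"
      using \<epsilon> by (intro weak_perp\<epsilon>[OF L]) (simp add: inner_diff_right inner_commute)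
    moreover have "weakly_invariant \<Omega> ((u \<bullet> \<epsilon>) *\<^sub>R \<epsilon>) (\<lambda>x. F x \<bullet> b)"
      using subspace_mul[OF sub[OF L]] to_weak[OF L inv_\<epsilon>] by auto
    ultimately have "weakly_invariant \<Omega> u (\<lambda>x. F x \<bullet> b)"
      using subspace_add[OF sub[OF L], of "u - (u \<bullet> \<epsilon>) *\<^sub>R \<epsilon>" "(u \<bullet> \<epsilon>) *\<^sub>R \<epsilon>"] by simp
    then show "translation_invariant \<Omega> u (\<lambda>x. F x \<bullet> b)"
      by (rule to_translation[OF L])
  qed (auto intro: euclidean_eqI)
  then show ?thesis
    by (rule translation_invariant_imp_constant[OF F \<Omega>])
qed


section \<open>Passage from Lebesgue to Borel measurable fields\<close>

text \<open>The Lebesgue measurable field extended by zero differs from a Borel one on a null set only,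
  component by component.\<close>

lemma borel_representative:
  fixes B :: "'a::euclidean_space \<Rightarrow> 'b::euclidean_space"
  assumes B: "B \<in> borel_measurable (lebesgue_on \<Omega>)" and \<Omega>: "\<Omega> \<in> sets borel"
  obtains F where "F \<in> borel_measurable borel" "AE x in lborel. x \<in> \<Omega> \<longrightarrow> F x = B x"
proof -
  have "\<Omega> \<inter> space lebesgue \<in> sets lebesgue" using \<Omega> by (simp add: sets_completionI_sets)
  with B have [measurable]: "(\<lambda>x. indicator \<Omega> x *\<^sub>R B x) \<in> borel_measurable lebesgue"
    by (simp add: borel_measurable_restrict_space_iff)
  have "\<exists>g\<in>borel_measurable lborel. AE x in lborel. (indicator \<Omega> x *\<^sub>R B x) \<bullet> b = g x" for b
    by (rule completion_ex_borel_measurable_real) measurable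
  then obtain g where g: "\<And>b. g b \<in> borel_measurable lborel"
    "\<And>b. AE x in lborel. (indicator \<Omega> x *\<^sub>R B x) \<bullet> b = g b x"
    by metis
  show thesis
  proof (rule that[of "\<lambda>x. \<Sum>b\<in>Basis. g b x *\<^sub>R b"])
    show "(\<lambda>x. \<Sum>b\<in>Basis. g b x *\<^sub>R b) \<in> borel_measurable borel"
      using g(1) by auto
    have "AE x in lborel. \<forall>b\<in>Basis. (indicator \<Omega> x *\<^sub>R B x) \<bullet> b = g b x"
      using g(2) by (subst AE_finite_all) auto
    then show "AE x in lborel. x \<in> \<Omega> \<longrightarrow> (\<Sum>b\<in>Basis. g b x *\<^sub>R b) = B x"
    proof eventually_elim
      case (elim x)
      show ?case
      proof
        assume "x \<in> \<Omega>"
        with elim have "(\<Sum>b\<in>Basis. g b x *\<^sub>R b) = (\<Sum>b\<in>Basis. (B x \<bullet> b) *\<^sub>R b)"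
          by (intro sum.cong) auto
        then show "(\<Sum>b\<in>Basis. g b x *\<^sub>R b) = B x"
          by (simp add: euclidean_representation)
      qed
    qed
  qed
qed

lemma AE_lebesgue_on_iff:
  assumes "\<Omega> \<in> sets borel"
  shows "(AE x in lebesgue_on \<Omega>. P x) \<longleftrightarrow> (AE x in lborel. x \<in> \<Omega> \<longrightarrow> P x)"
  using assms by (subst AE_restrict_space_iff) (auto simp: sets_completionI_sets AE_completion_iff)

theorem theorem1p8:
  fixes \<Omega> :: "(real^'n) set"
    and K :: "(real^'n^'m) set"
    and \<pi> :: "nat \<Rightarrow> (real^'n) set"
    and \<tau> :: "nat \<Rightarrow> (real^'m) set"
    and B :: "real^'n \<Rightarrow> real^'n^'m"
  assumes "CARD('m) \<ge> CARD('n)"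
    and "open \<Omega>" and "connected \<Omega>"
    and "bounded K"
    and "\<And>A A'. A \<in> K \<Longrightarrow> A' \<in> K \<Longrightarrow> A \<noteq> A' \<Longrightarrow> rank (A - A') = CARD('n)"
    and "\<And>r. r \<in> {1..CARD('n) - 1} \<Longrightarrow> subspace (\<pi> r) \<and> dim (\<pi> r) = CARD('n) - 1"
    and "independent_hyperplanes {1..CARD('n) - 1} \<pi>"
    and "\<And>r. r \<in> {1..CARD('n) - 1} \<Longrightarrow> subspace (\<tau> r) \<and> dim (\<tau> r) = CARD('n) - 1"
    and "\<And>A r. A \<in> K \<Longrightarrow> r \<in> {1..CARD('n) - 1} \<Longrightarrow> (\<lambda>x. A *v x) ` \<pi> r \<subseteq> \<tau> r"
    and "B \<in> borel_measurable (lebesgue_on \<Omega>)"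
    and "AE x in lebesgue_on \<Omega>. B x \<in> K"
    and "Div_free_on \<Omega> B"
  shows "\<exists>C. AE x in lebesgue_on \<Omega>. B x = C"
proof -
  have \<Omega>[measurable]: "\<Omega> \<in> sets borel" using \<open>open \<Omega>\<close> by simp
  obtain F0 where [measurable]: "F0 \<in> borel_measurable borel"
    and F0: "AE x in lborel. x \<in> \<Omega> \<longrightarrow> F0 x = B x"
    using borel_representative[OF assms(10) \<Omega>] by blast
  obtain M where M: "0 < M" "\<And>A. A \<in> K \<Longrightarrow> norm A \<le> M"
    using \<open>bounded K\<close> bounded_pos by blast
  \<comment> \<open>Truncation turns the almost everywhere bound from \<open>K\<close> into a bound everywhere.\<close>
  define F where "F x = (if norm (F0 x) \<le> M then F0 x else 0)" for x
  have F[measurable]: "F \<in> borel_measurable borel"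
    unfolding F_def by measurable
  have F_bound: "norm (F x) \<le> M" for x
    using M(1) by (simp add: F_def)
  have BK: "AE x in lborel. x \<in> \<Omega> \<longrightarrow> B x \<in> K"
    using assms(11) by (simp add: AE_lebesgue_on_iff[OF \<Omega>])
  have FB: "AE x in lborel. x \<in> \<Omega> \<longrightarrow> F x = B x"
    using F0 BK by eventually_elim (auto simp: F_def M(2))
  have FK: "AE x in lborel. x \<in> \<Omega> \<longrightarrow> F x \<in> K"
    using FB BK by eventually_elim auto
  have div: "(LINT x|lborel. directional_derivative \<phi> (row i (F x)) x) = 0"
    if \<phi>: "\<phi> \<in> test_functions \<Omega>" for \<phi> i
  proof -
    have row: "(\<lambda>A::real^'n^'m. row i A) \<in> borel_measurable borel"
      by (intro borel_measurable_continuous_onI linear_continuous_on linear_conv_bounded_linear[THEN iffD1])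
        (auto simp: linear_iff row_def vec_eq_iff)
    have "gradient \<phi> \<in> borel_measurable borel"
      unfolding gradient_def
      by (intro borel_measurable_continuous_onI continuous_intros continuous_on_directional_derivative[OF \<phi>])
    have grad: "(\<lambda>x. row i (F x) \<bullet> gradient \<phi> x) \<in> borel_measurable borel"
      using measurable_compose[OF F row] \<open>gradient \<phi> \<in> _\<close> by measurable
    have grad_leb: "f \<in> borel_measurable (lebesgue_on \<Omega>)" if "f \<in> borel_measurable borel" for f :: "real^'n \<Rightarrow> 'z::topological_space"
      using that by (intro measurable_restrict_space1 measurable_completion) simp
    have "(LINT x|lborel. row i (F x) \<bullet> gradient \<phi> x)
        = (LINT x|lebesgue. row i (F x) \<bullet> gradient \<phi> x)"
      using grad by (simp add: integral_completion)
    also have "\<dots> = (LINT x|lebesgue. indicator \<Omega> x *\<^sub>R (row i (F x) \<bullet> gradient \<phi> x))"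
    proof (intro Bochner_Integration.integral_cong refl)
      fix x
      show "row i (F x) \<bullet> gradient \<phi> x = indicator \<Omega> x *\<^sub>R (row i (F x) \<bullet> gradient \<phi> x)"
        unfolding inner_gradient[OF \<phi>]
        using directional_derivative_eq_0[of x \<phi>] test_function_support(2)[OF \<phi>]
        by (cases "x \<in> \<Omega>") auto
    qed
    also have "\<dots> = (LINT x|lebesgue_on \<Omega>. row i (F x) \<bullet> gradient \<phi> x)"
      by (subst integral_restrict_space) (auto simp: sets_completionI_sets)
    also have "\<dots> = (LINT x|lebesgue_on \<Omega>. row i (B x) \<bullet> gradient \<phi> x)"
    proof (rule integral_cong_AE)
      show "(\<lambda>x. row i (F x) \<bullet> gradient \<phi> x) \<in> borel_measurable (lebesgue_on \<Omega>)"
        by (rule grad_leb[OF grad])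
      show "(\<lambda>x. row i (B x) \<bullet> gradient \<phi> x) \<in> borel_measurable (lebesgue_on \<Omega>)"
        by (intro borel_measurable_inner measurable_compose[OF assms(10) row] grad_leb[OF \<open>gradient \<phi> \<in> _\<close>])
      show "AE x in lebesgue_on \<Omega>. row i (F x) \<bullet> gradient \<phi> x = row i (B x) \<bullet> gradient \<phi> x"
        unfolding AE_lebesgue_on_iff[OF \<Omega>] using FB by eventually_elim simp
    qed
    also have "\<dots> = 0"
      using assms(12) \<phi> by (simp add: Div_free_on_def divergence_free_on_def)
    finally show ?thesis by (simp add: inner_gradient[OF \<phi>])
  qed
  obtain C where "AE x in lborel. x \<in> \<Omega> \<longrightarrow> F x = C"
    using borel_field_constant[OF assms(2,3,5) _ _ assms(6-9) F F_bound FK div] by auto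
  with FB have "AE x in lborel. x \<in> \<Omega> \<longrightarrow> B x = C"
    by eventually_elim auto
  then show ?thesis
    unfolding AE_lebesgue_on_iff[OF \<Omega>] by blast
qed

end
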